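(* Let $(A,\pi A,F)$ be a complete discrete valuation ring of mixed characteristic $(0,p)$ with finite residue field $F=A/\pi A$. Let $R=A[X_1,\ldots,X_n]$ be standard $\mathbb{N}^n$-graded, let $I$ be a $\mathfrak{C}$-monomial ideal of $R$, let $i\ge 0$, and let $M=H^i_I(R)=\bigoplus_{\underline{u}\in\mathbb{Z}^n}M_{\underline{u}}$. For each $\underline{u}\in\mathbb{Z}^n$ let $l(\underline{u}),t(\underline{u})\ge 0$ and $\beta_j(\underline{u})\ge 1$ ($1\le j\le t(\underline{u})$) be the finite numbers with $$\Gamma_{\pi}(M_{\underline{u}})\cong E_A\left(\frac{A}{\pi A}\right)^{l(\underline{u})}\oplus\left(\bigoplus_{j=1}^{t(\underline{u})}\frac{A}{\pi^{\beta_j(\underline{u})}A}\right)$$ as $A$-modules. Then for each subset $U\subseteq\{1,\ldots,n\}$ the functions $\underline{u}\mapsto l(\underline{u})$ and $\underline{u}\mapsto t(\underline{u})$ are constant on the block $\mathcal{B}(U)$.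
   Context: Standard $\mathbb{N}^n$-grading: $\deg a=\underline{0}$ for $a\in A$ and $\deg X_j=e_j$, the $j$-th standard basis vector. An ideal $I$ of $R$ is $\mathfrak{C}$-monomial if it can be generated by elements of the form $a\,m$, where $a\in A$ (not necessarily a unit) and $m$ is a monomial in $X_1,\ldots,X_n$. For such $I$ the local cohomology module $H^i_I(R)$ carries a natural $\mathbb{Z}^n$-grading, and $M_{\underline{u}}$ denotes its component (an $A$-module) of degree $\underline{u}$. For an $A$-module $N$, $\Gamma_\pi(N)=\{x\in N:\pi^k x=0\text{ for some }k\ge 0\}$. $E_A(A/\pi A)$ is the injective hull of $A/\pi A$ over $A$. Recalled from earlier work (may be taken as known): for each $\underline{u}$ the displayed decomposition of $\Gamma_\pi(M_{\underline{u}})$, with finite numbers $l(\underline{u}),t(\underline{u}),\beta_j(\underline{u})$, exists. Blocks: for $U\subseteq\{1,\ldots,n\}$, $\mathcal{B}(U)=\{\underline{u}\in\mathbb{Z}^n: u_k\ge 0\text{ if }k\in U,\ u_k\le -1\text{ if }k\notin U\}$. *)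

theory Defs
  imports "HOL-Algebra.Module" "HOL-Algebra.QuotRing" "HOL-Algebra.Ring_Divisibility"
    "HOL-Computational_Algebra.Primes"
begin

section \<open>Modules\<close>

text \<open>The record type of modules extends that of rings; its fields \<open>mult\<close> and \<open>one\<close> play no role
  in the module axioms and are left unspecified in the constructions below.\<close>

definition self_module :: "('a, 'c) ring_scheme \<Rightarrow> ('a, 'a) module" where
  "self_module R = \<lparr>carrier = carrier R, monoid.mult = monoid.mult R, one = one R,
     ring.zero = ring.zero R, add = add R, smult = monoid.mult R\<rparr>"

definition restrict_scalars :: "('a \<Rightarrow> 'b) \<Rightarrow> ('b, 'm) module \<Rightarrow> ('a, 'm) module" where
  "restrict_scalars \<phi> M = \<lparr>carrier = carrier M, monoid.mult = monoid.mult M, one = one M,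
     ring.zero = ring.zero M, add = add M, smult = (\<lambda>a. smult M (\<phi> a))\<rparr>"

definition quot_module :: "('a, 'm) module \<Rightarrow> 'm set \<Rightarrow> ('a, 'm set) module" where
  "quot_module M N = \<lparr>carrier = a_rcosets\<^bsub>M\<^esub> N, monoid.mult = undefined, one = undefined, ring.zero = N,
     add = (\<lambda>X Y. X <+>\<^bsub>M\<^esub> Y), smult = (\<lambda>a X. \<Union>x\<in>X. N +>\<^bsub>M\<^esub> (a \<odot>\<^bsub>M\<^esub> x))\<rparr>"

text \<open>Product of a family; used for finite index sets only, where it is the direct sum.\<close>

definition prod_module :: "'i set \<Rightarrow> ('i \<Rightarrow> ('a, 'm) module) \<Rightarrow> ('a, 'i \<Rightarrow> 'm) module" where
  "prod_module J M = \<lparr>carrier = (\<Pi>\<^sub>E j\<in>J. carrier (M j)), monoid.mult = undefined, one = undefined,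
     ring.zero = (\<lambda>j\<in>J. \<zero>\<^bsub>M j\<^esub>), add = (\<lambda>x y. \<lambda>j\<in>J. x j \<oplus>\<^bsub>M j\<^esub> y j),
     smult = (\<lambda>a x. \<lambda>j\<in>J. a \<odot>\<^bsub>M j\<^esub> x j)\<rparr>"

definition sum_module :: "('a, 'm) module \<Rightarrow> ('a, 'k) module \<Rightarrow> ('a, 'm \<times> 'k) module" where
  "sum_module M N = \<lparr>carrier = carrier M \<times> carrier N, monoid.mult = undefined, one = undefined,
     ring.zero = (\<zero>\<^bsub>M\<^esub>, \<zero>\<^bsub>N\<^esub>), add = (\<lambda>(x, y) (x', y'). (x \<oplus>\<^bsub>M\<^esub> x', y \<oplus>\<^bsub>N\<^esub> y')),
     smult = (\<lambda>a (x, y). (a \<odot>\<^bsub>M\<^esub> x, a \<odot>\<^bsub>N\<^esub> y))\<rparr>"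

definition module_hom ::
    "('a, 'c) ring_scheme \<Rightarrow> ('a, 'm) module \<Rightarrow> ('a, 'k) module \<Rightarrow> ('m \<Rightarrow> 'k) set" where
  "module_hom R M N = {h \<in> carrier M \<rightarrow> carrier N.
     (\<forall>x\<in>carrier M. \<forall>y\<in>carrier M. h (x \<oplus>\<^bsub>M\<^esub> y) = h x \<oplus>\<^bsub>N\<^esub> h y) \<and>
     (\<forall>a\<in>carrier R. \<forall>x\<in>carrier M. h (a \<odot>\<^bsub>M\<^esub> x) = a \<odot>\<^bsub>N\<^esub> h x)}"

definition module_iso :: "('a, 'c) ring_scheme \<Rightarrow> ('a, 'm) module \<Rightarrow> ('a, 'k) module \<Rightarrow> bool" where
  "module_iso R M N \<longleftrightarrow> (\<exists>h\<in>module_hom R M N. bij_betw h (carrier M) (carrier N))"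

definition torsion_module :: "('a, 'c) ring_scheme \<Rightarrow> 'a \<Rightarrow> ('a, 'm) module \<Rightarrow> ('a, 'm) module" where
  "torsion_module R a M =
     M\<lparr>carrier := {x \<in> carrier M. \<exists>k::nat. (a [^]\<^bsub>R\<^esub> k) \<odot>\<^bsub>M\<^esub> x = \<zero>\<^bsub>M\<^esub>}\<rparr>"

text \<open>The test modules have their elements in the type of the elements of the ring, since one
  cannot quantify over types here. This is no restriction: the ideals of the ring are among the
  test modules, so Baer's criterion applies.\<close>

definition injective_module :: "('a, 'c) ring_scheme \<Rightarrow> ('a, 'e) module \<Rightarrow> bool" where
  "injective_module R E \<longleftrightarrow> module R E \<and>
     (\<forall>(M :: ('a, 'a) module) (N :: ('a, 'a) module) f g.
        module R M \<longrightarrow> module R N \<longrightarrow>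
        f \<in> module_hom R M N \<longrightarrow> inj_on f (carrier M) \<longrightarrow> g \<in> module_hom R M E \<longrightarrow>
        (\<exists>h\<in>module_hom R N E. \<forall>x\<in>carrier M. h (f x) = g x))"

definition injective_hull ::
    "('a, 'c) ring_scheme \<Rightarrow> ('a, 'm) module \<Rightarrow> ('a, 'e) module \<Rightarrow> bool" where
  "injective_hull R N E \<longleftrightarrow> injective_module R E \<and>
     (\<exists>\<iota>\<in>module_hom R N E. inj_on \<iota> (carrier N) \<and>
        (\<forall>K. submodule K R E \<longrightarrow> K \<noteq> {\<zero>\<^bsub>E\<^esub>} \<longrightarrow> K \<inter> \<iota> ` carrier N \<noteq> {\<zero>\<^bsub>E\<^esub>}))"


section \<open>Complete discrete valuation rings of mixed characteristic\<close>

definition has_char :: "('a, 'c) ring_scheme \<Rightarrow> nat \<Rightarrow> bool" where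
  "has_char R c \<longleftrightarrow> (\<forall>k::nat. [k] \<cdot>\<^bsub>R\<^esub> \<one>\<^bsub>R\<^esub> = \<zero>\<^bsub>R\<^esub> \<longleftrightarrow> c dvd k)"

text \<open>A discrete valuation ring is a local principal ideal domain that is not a field.
  In the definition of completeness, separatedness is automatic and only convergence is required.\<close>

locale discrete_valuation_ring = principal_domain A for A (structure) +
  fixes \<pi>
  assumes uniformizer_closed: "\<pi> \<in> carrier A"
    and uniformizer_nonzero: "\<pi> \<noteq> \<zero>"
    and uniformizer_maximal: "maximalideal (PIdl \<pi>) A"
    and local_ring: "\<And>J. maximalideal J A \<Longrightarrow> J = PIdl \<pi>"

locale complete_dvr = discrete_valuation_ring +
  assumes complete: "\<And>s :: nat \<Rightarrow> 'a. range s \<subseteq> carrier A \<Longrightarrow>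
      (\<And>k. s (Suc k) \<ominus> s k \<in> PIdl (\<pi> [^] k)) \<Longrightarrow>
      \<exists>a\<in>carrier A. \<forall>k. a \<ominus> s k \<in> PIdl (\<pi> [^] k)"

locale mixed_char_complete_dvr = complete_dvr +
  fixes p :: nat
  assumes residue_char_prime: "Factorial_Ring.prime p"
    and char_zero: "has_char A 0"
    and residue_char: "has_char (A Quot (PIdl \<pi>)) p"


section \<open>Polynomial rings\<close>

text \<open>The polynomial ring over \<open>A\<close> with variables indexed by the finite type \<open>'n\<close>: a monomial is
  its exponent vector, a polynomial its coefficient function.\<close>

definition mpoly_ring :: "('a, 'c) ring_scheme \<Rightarrow> (('n::finite \<Rightarrow> nat) \<Rightarrow> 'a) ring" where
  "mpoly_ring A = \<lparr>carrier = {f. range f \<subseteq> carrier A \<and> finite {m. f m \<noteq> \<zero>\<^bsub>A\<^esub>}},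
     monoid.mult = (\<lambda>f g m.
       finsum A (\<lambda>(a, b). f a \<otimes>\<^bsub>A\<^esub> g b) {(a, b). \<forall>i. a i + b i = m i}),
     one = (\<lambda>m. if m = (\<lambda>_. 0) then \<one>\<^bsub>A\<^esub> else \<zero>\<^bsub>A\<^esub>),
     ring.zero = (\<lambda>_. \<zero>\<^bsub>A\<^esub>),
     add = (\<lambda>f g m. f m \<oplus>\<^bsub>A\<^esub> g m)\<rparr>"

definition mterm :: "('a, 'c) ring_scheme \<Rightarrow> 'a \<Rightarrow> ('n::finite \<Rightarrow> nat) \<Rightarrow> ('n \<Rightarrow> nat) \<Rightarrow> 'a" where
  "mterm A a m = (\<lambda>m'. if m' = m then a else \<zero>\<^bsub>A\<^esub>)"

definition mterms :: "('a, 'c) ring_scheme \<Rightarrow> (('n::finite \<Rightarrow> nat) \<Rightarrow> 'a) set" where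
  "mterms A = {mterm A a m | a m. a \<in> carrier A}"

definition mconst :: "('a, 'c) ring_scheme \<Rightarrow> 'a \<Rightarrow> ('n::finite \<Rightarrow> nat) \<Rightarrow> 'a" where
  "mconst A a = mterm A a (\<lambda>_. 0)"

definition C_monomial_ideal ::
    "('a, 'c) ring_scheme \<Rightarrow> (('n::finite \<Rightarrow> nat) \<Rightarrow> 'a) set \<Rightarrow> bool" where
  "C_monomial_ideal A I \<longleftrightarrow> (\<exists>S\<subseteq>mterms A. I = Idl\<^bsub>mpoly_ring A\<^esub> S)"

definition homogeneous ::
    "('a, 'c) ring_scheme \<Rightarrow> ('n::finite \<Rightarrow> int) \<Rightarrow> (('n \<Rightarrow> nat) \<Rightarrow> 'a) \<Rightarrow> bool" where
  "homogeneous A w f \<longleftrightarrow>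
     f \<in> carrier (mpoly_ring A) \<and> (\<forall>m. f m \<noteq> \<zero>\<^bsub>A\<^esub> \<longrightarrow> (\<forall>i. int (m i) = w i))"


section \<open>Localization at the powers of an element\<close>

text \<open>\<open>loc_frac R f r k\<close> is the fraction \<open>r / f ^ k\<close>, the class of all pairs \<open>(s, l)\<close> with
  \<open>f ^ m * (f ^ l * r - f ^ k * s) = 0\<close> for some \<open>m\<close>.\<close>

definition loc_frac :: "('r, 'c) ring_scheme \<Rightarrow> 'r \<Rightarrow> 'r \<Rightarrow> nat \<Rightarrow> ('r \<times> nat) set" where
  "loc_frac R f r k = {(s, l). s \<in> carrier R \<and> (\<exists>m::nat.
     f [^]\<^bsub>R\<^esub> m \<otimes>\<^bsub>R\<^esub> (f [^]\<^bsub>R\<^esub> l \<otimes>\<^bsub>R\<^esub> r) = f [^]\<^bsub>R\<^esub> m \<otimes>\<^bsub>R\<^esub> (f [^]\<^bsub>R\<^esub> k \<otimes>\<^bsub>R\<^esub> s))}"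

definition localization :: "('r, 'c) ring_scheme \<Rightarrow> 'r \<Rightarrow> ('r, ('r \<times> nat) set) module" where
  "localization R f = \<lparr>carrier = {loc_frac R f r k | r k. r \<in> carrier R},
     monoid.mult = (\<lambda>X Y. \<Union>(r, k)\<in>X. \<Union>(s, l)\<in>Y. loc_frac R f (r \<otimes>\<^bsub>R\<^esub> s) (k + l)),
     one = loc_frac R f \<one>\<^bsub>R\<^esub> 0,
     ring.zero = loc_frac R f \<zero>\<^bsub>R\<^esub> 0,
     add = (\<lambda>X Y. \<Union>(r, k)\<in>X. \<Union>(s, l)\<in>Y.
       loc_frac R f (f [^]\<^bsub>R\<^esub> l \<otimes>\<^bsub>R\<^esub> r \<oplus>\<^bsub>R\<^esub> f [^]\<^bsub>R\<^esub> k \<otimes>\<^bsub>R\<^esub> s) (k + l)),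
     smult = (\<lambda>a X. \<Union>(r, k)\<in>X. loc_frac R f (a \<otimes>\<^bsub>R\<^esub> r) k)\<rparr>"

text \<open>The canonical map from the localization at \<open>f\<close> to the localization at \<open>f * h\<close>, sending
  \<open>r / f ^ k\<close> to \<open>h ^ k * r / (f * h) ^ k\<close>.\<close>

definition loc_map ::
    "('r, 'c) ring_scheme \<Rightarrow> 'r \<Rightarrow> 'r \<Rightarrow> ('r \<times> nat) set \<Rightarrow> ('r \<times> nat) set" where
  "loc_map R f h X = (\<Union>(r, k)\<in>X. loc_frac R (f \<otimes>\<^bsub>R\<^esub> h) (h [^]\<^bsub>R\<^esub> k \<otimes>\<^bsub>R\<^esub> r) k)"


section \<open>Local cohomology\<close>

text \<open>The local cohomology of a Noetherian ring \<open>R\<close> with support in the ideal generated by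
  the list \<open>gs\<close> is the cohomology of the Cech complex on \<open>gs\<close>, whose \<open>i\<close>-th term is the product
  of the localizations of \<open>R\<close> at the products of \<open>i\<close> members of \<open>gs\<close> (at distinct positions).
  It depends on the choice of generators only up to isomorphism.\<close>

definition cech_index :: "'r list \<Rightarrow> nat \<Rightarrow> nat set set" where
  "cech_index gs i = {S. S \<subseteq> {..<length gs} \<and> card S = i}"

definition cech_elt :: "('r, 'c) ring_scheme \<Rightarrow> 'r list \<Rightarrow> nat set \<Rightarrow> 'r" where
  "cech_elt R gs S = (\<Otimes>\<^bsub>R\<^esub>j\<in>S. gs ! j)"

definition cech_module ::
    "('r, 'c) ring_scheme \<Rightarrow> 'r list \<Rightarrow> nat \<Rightarrow> ('r, nat set \<Rightarrow> ('r \<times> nat) set) module" where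
  "cech_module R gs i = prod_module (cech_index gs i) (\<lambda>S. localization R (cech_elt R gs S))"

definition cech_diff :: "('r, 'c) ring_scheme \<Rightarrow> 'r list \<Rightarrow> nat \<Rightarrow>
    (nat set \<Rightarrow> ('r \<times> nat) set) \<Rightarrow> (nat set \<Rightarrow> ('r \<times> nat) set)" where
  "cech_diff R gs i x = (\<lambda>T\<in>cech_index gs (Suc i).
     let L = localization R (cech_elt R gs T) in
     \<Oplus>\<^bsub>L\<^esub>j\<in>T. let y = loc_map R (cech_elt R gs (T - {j})) (gs ! j) (x (T - {j})) in
       if even (card {k \<in> T. k < j}) then y else \<ominus>\<^bsub>L\<^esub> y)"

definition cech_cocycles ::
    "('r, 'c) ring_scheme \<Rightarrow> 'r list \<Rightarrow> nat \<Rightarrow> (nat set \<Rightarrow> ('r \<times> nat) set) set" where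
  "cech_cocycles R gs i =
     {x \<in> carrier (cech_module R gs i). cech_diff R gs i x = \<zero>\<^bsub>cech_module R gs (Suc i)\<^esub>}"

definition cech_coboundaries ::
    "('r, 'c) ring_scheme \<Rightarrow> 'r list \<Rightarrow> nat \<Rightarrow> (nat set \<Rightarrow> ('r \<times> nat) set) set" where
  "cech_coboundaries R gs i =
     (case i of 0 \<Rightarrow> {\<zero>\<^bsub>cech_module R gs 0\<^esub>}
      | Suc k \<Rightarrow> cech_diff R gs k ` carrier (cech_module R gs k))"

definition local_cohomology ::
    "('r, 'c) ring_scheme \<Rightarrow> 'r list \<Rightarrow> nat \<Rightarrow> ('r, (nat set \<Rightarrow> ('r \<times> nat) set) set) module" where
  "local_cohomology R gs i =
     quot_module ((cech_module R gs i)\<lparr>carrier := cech_cocycles R gs i\<rparr>) (cech_coboundaries R gs i)"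


section \<open>The grading on local cohomology\<close>

text \<open>For homogeneous \<open>f\<close> of degree \<open>d\<close>, the fraction \<open>r / f ^ k\<close> has degree \<open>u\<close> if \<open>r\<close> is homogeneous
  of degree \<open>u + k d\<close>. (The degree \<open>d\<close> is unique unless \<open>f = 0\<close>, when the localization is zero.)\<close>

definition loc_component :: "('a, 'c) ring_scheme \<Rightarrow> (('n::finite \<Rightarrow> nat) \<Rightarrow> 'a) \<Rightarrow> ('n \<Rightarrow> int) \<Rightarrow>
    ((('n \<Rightarrow> nat) \<Rightarrow> 'a) \<times> nat) set set" where
  "loc_component A f u = {loc_frac (mpoly_ring A) f r k | r k d.
     homogeneous A d f \<and> homogeneous A (\<lambda>i. u i + int k * d i) r}"

text \<open>For a list \<open>gs\<close> of homogeneous polynomials, the component of degree \<open>u\<close> of local cohomology,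
  as a module over the coefficient ring: it consists of the classes of those cocycles all of whose
  entries have degree \<open>u\<close>.\<close>

definition lc_component ::
    "('a, 'c) ring_scheme \<Rightarrow> (('n::finite \<Rightarrow> nat) \<Rightarrow> 'a) list \<Rightarrow> nat \<Rightarrow> ('n \<Rightarrow> int) \<Rightarrow>
     ('a, (nat set \<Rightarrow> ((('n \<Rightarrow> nat) \<Rightarrow> 'a) \<times> nat) set) set) module" where
  "lc_component A gs i u = (let R = mpoly_ring A in
     (restrict_scalars (mconst A) (local_cohomology R gs i))
       \<lparr>carrier := {cech_coboundaries R gs i +>\<^bsub>cech_module R gs i\<^esub> x | x.
          x \<in> cech_cocycles R gs i \<and>
          (\<forall>S\<in>cech_index gs i. x S \<in> loc_component A (cech_elt R gs S) u)}\<rparr>)"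

definition block :: "'n set \<Rightarrow> ('n \<Rightarrow> int) set" where
  "block U = {u. (\<forall>k\<in>U. u k \<ge> 0) \<and> (\<forall>k. k \<notin> U \<longrightarrow> u k \<le> -1)}"

end

(* Localized at a term f = a X^m, the polynomial ring has degree-u component isomorphic to A_a when
   every negative coordinate of u lies in the support of m, and zero otherwise.  On a block these
   components are identified by c X^(u + k m) / f^k |-> c X^(v + k m) / f^k for k large, and this is
   compatible with the Cech differentials; hence M_u and M_v are isomorphic A-modules whenever u and
   v lie in the same block.  The numbers l and t are invariants of the torsion submodule: with q the
   order of the residue field, its pi-socle has q^(l + t) elements, of which q^l are divisible by
   every power of pi. *)

theory Submission
  imports Defs
begin

text \<open>A component M_u consists of cosets modulo all coboundaries, not only those of degree u,
  so a bijection between graded pieces would not by itself act on cosets. The translation is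
  therefore extended by zero: \<open>shift\<close> from u to v is defined on the whole localization,
  as the projection onto degree u followed by the translation. It is an A-linear endomorphism of the
  complex commuting with the differentials, hence preserves cocycles and coboundaries. For u = v it
  is the projection, and having degree u is expressed as being fixed by it; no direct sum
  decomposition has to be established. The bound on k comes from an asymmetry: reading a coefficient
  at the exponent u + k m is always compatible with multiplication by f^l, but writing a term at v +
  k m is so only when this exponent is non-negative or the coefficient is zero. In a block, u and v
  have equal signs where m vanishes; elsewhere k m dominates. E is known only as an injective hull,
  so the counts rest on what this gives directly: E is divisible, and its socle is the copy of the
  residue field.\<close>

section \<open>Modules\<close>

lemma module_abelian_group: "module R M \<Longrightarrow> abelian_group M"
  by (simp add: module_def)

text \<open>Self modules, restrictions of scalars and quotients are new records over a known
  additive group; this transfers the group axioms to them.\<close>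

lemma comm_group_imp_abelian_group:
  assumes "comm_group G" and "carrier M = carrier G" "add M = monoid.mult G" "zero M = one G"
  shows "abelian_group M"
proof -
  interpret comm_group G by fact
  show ?thesis
    by (rule abelian_groupI) (use assms in \<open>auto simp: m_ac intro: l_inv_ex\<close>)
qed

lemma module_homI:
  assumes "\<And>x. x \<in> carrier M \<Longrightarrow> h x \<in> carrier N"
    and "\<And>x y. x \<in> carrier M \<Longrightarrow> y \<in> carrier M \<Longrightarrow> h (x \<oplus>\<^bsub>M\<^esub> y) = h x \<oplus>\<^bsub>N\<^esub> h y"
    and "\<And>a x. a \<in> carrier R \<Longrightarrow> x \<in> carrier M \<Longrightarrow> h (a \<odot>\<^bsub>M\<^esub> x) = a \<odot>\<^bsub>N\<^esub> h x"
  shows "h \<in> module_hom R M N"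
  using assms by (auto simp: module_hom_def)

lemma module_homD:
  assumes "h \<in> module_hom R M N"
  shows "x \<in> carrier M \<Longrightarrow> h x \<in> carrier N"
    and "x \<in> carrier M \<Longrightarrow> y \<in> carrier M \<Longrightarrow> h (x \<oplus>\<^bsub>M\<^esub> y) = h x \<oplus>\<^bsub>N\<^esub> h y"
    and "a \<in> carrier R \<Longrightarrow> x \<in> carrier M \<Longrightarrow> h (a \<odot>\<^bsub>M\<^esub> x) = a \<odot>\<^bsub>N\<^esub> h x"
  using assms by (auto simp: module_hom_def)

text \<open>Only additivity is assumed here and in the next two lemmas: the degree shifts, which
  enter through \<open>cech_diff_natural\<close>, are not linear over the polynomial ring.\<close>

lemma additive_map_zero:
  assumes "abelian_group M" "abelian_group N"
    and "\<And>x. x \<in> carrier M \<Longrightarrow> h x \<in> carrier N"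
    and "\<And>x y. x \<in> carrier M \<Longrightarrow> y \<in> carrier M \<Longrightarrow> h (x \<oplus>\<^bsub>M\<^esub> y) = h x \<oplus>\<^bsub>N\<^esub> h y"
  shows "h \<zero>\<^bsub>M\<^esub> = \<zero>\<^bsub>N\<^esub>"
proof -
  interpret M: abelian_group M by fact
  interpret N: abelian_group N by fact
  have "h \<zero>\<^bsub>M\<^esub> \<oplus>\<^bsub>N\<^esub> h \<zero>\<^bsub>M\<^esub> = h \<zero>\<^bsub>M\<^esub>"
    using assms(4)[of "\<zero>\<^bsub>M\<^esub>" "\<zero>\<^bsub>M\<^esub>"] by simp
  then show ?thesis
    by (simp add: assms(3))
qed

lemma additive_map_minus:
  assumes "abelian_group M" "abelian_group N"
    and "\<And>x. x \<in> carrier M \<Longrightarrow> h x \<in> carrier N"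
    and "\<And>x y. x \<in> carrier M \<Longrightarrow> y \<in> carrier M \<Longrightarrow> h (x \<oplus>\<^bsub>M\<^esub> y) = h x \<oplus>\<^bsub>N\<^esub> h y"
    and x: "x \<in> carrier M"
  shows "h (\<ominus>\<^bsub>M\<^esub> x) = \<ominus>\<^bsub>N\<^esub> h x"
proof -
  interpret M: abelian_group M by fact
  interpret N: abelian_group N by fact
  have "h (\<ominus>\<^bsub>M\<^esub> x) \<oplus>\<^bsub>N\<^esub> h x = \<zero>\<^bsub>N\<^esub>"
    using assms(4)[of "\<ominus>\<^bsub>M\<^esub> x" x] additive_map_zero[of M N h] assms by (simp add: M.l_neg)
  then show ?thesis
    by (metis N.minus_equality assms(3) M.a_inv_closed x)
qed

lemma additive_map_finsum:
  assumes "abelian_group M" "abelian_group N"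
    and "\<And>x. x \<in> carrier M \<Longrightarrow> h x \<in> carrier N"
    and "\<And>x y. x \<in> carrier M \<Longrightarrow> y \<in> carrier M \<Longrightarrow> h (x \<oplus>\<^bsub>M\<^esub> y) = h x \<oplus>\<^bsub>N\<^esub> h y"
    and "finite J" and "f \<in> J \<rightarrow> carrier M"
  shows "h (\<Oplus>\<^bsub>M\<^esub>j\<in>J. f j) = (\<Oplus>\<^bsub>N\<^esub>j\<in>J. h (f j))"
proof -
  interpret M: abelian_group M by fact
  interpret N: abelian_group N by fact
  show ?thesis using assms(5,6)
  proof (induction J)
    case empty
    then show ?case using additive_map_zero[of M N h] assms by simp
  next
    case (insert j J)
    then show ?case using assms(3,4)
      by (simp add: Pi_iff M.finsum_insert N.finsum_insert)
  qed
qed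

lemma module_hom_zero:
  assumes "module R M" "module R N" "h \<in> module_hom R M N"
  shows "h \<zero>\<^bsub>M\<^esub> = \<zero>\<^bsub>N\<^esub>"
  by (rule additive_map_zero) (use assms in \<open>auto simp: module_def dest: module_homD\<close>)

lemma module_iso_sym:
  assumes "module R M" and "module_iso R M N"
  shows "module_iso R N M"
proof -
  interpret M: module R M by fact
  obtain h where h: "h \<in> module_hom R M N" and b: "bij_betw h (carrier M) (carrier N)"
    using assms by (auto simp: module_iso_def)
  define g where "g = the_inv_into (carrier M) h"
  have bg: "bij_betw g (carrier N) (carrier M)"
    unfolding g_def using b by (rule bij_betw_the_inv_into)
  have hg: "h (g y) = y" if "y \<in> carrier N" for y
    using b that unfolding g_def bij_betw_def by (simp add: f_the_inv_into_f)
  have gc: "g y \<in> carrier M" if "y \<in> carrier N" for y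
    using bg that by (auto simp: bij_betw_def)
  have eq: "x = x'" if "h x = h x'" "x \<in> carrier M" "x' \<in> carrier M" for x x'
    using b that by (auto simp: bij_betw_def inj_on_def)
  have hc: "h x \<in> carrier N" if "x \<in> carrier M" for x
    using module_homD(1)[OF h that] .
  have "g \<in> module_hom R N M"
  proof (rule module_homI)
    fix x y assume xy: "x \<in> carrier N" "y \<in> carrier N"
    have "h (g x \<oplus>\<^bsub>M\<^esub> g y) = x \<oplus>\<^bsub>N\<^esub> y"
      using xy module_homD(2)[OF h] by (simp add: gc hg)
    \<comment> \<open>\<open>N\<close> is a bare record here, so the closure of its carrier is
      obtained from \<open>M\<close> through \<open>h\<close>.\<close>
    moreover have "x \<oplus>\<^bsub>N\<^esub> y \<in> carrier N"
      using hc[of "g x \<oplus>\<^bsub>M\<^esub> g y"] calculation xy gc by simp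
    ultimately show "g (x \<oplus>\<^bsub>N\<^esub> y) = g x \<oplus>\<^bsub>M\<^esub> g y"
      using xy by (intro eq) (simp_all add: gc hg)
  next
    fix a x assume ax: "a \<in> carrier R" "x \<in> carrier N"
    have "h (a \<odot>\<^bsub>M\<^esub> g x) = a \<odot>\<^bsub>N\<^esub> x"
      using ax module_homD(3)[OF h] by (simp add: gc hg)
    moreover have "a \<odot>\<^bsub>N\<^esub> x \<in> carrier N"
      using hc[of "a \<odot>\<^bsub>M\<^esub> g x"] calculation ax gc by simp
    ultimately show "g (a \<odot>\<^bsub>N\<^esub> x) = a \<odot>\<^bsub>M\<^esub> g x"
      using ax by (intro eq) (simp_all add: gc hg)
  qed (rule gc)
  with bg show ?thesis by (auto simp: module_iso_def)
qed

lemma module_iso_trans: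
  assumes "module_iso R M N" and "module_iso R N K"
  shows "module_iso R M K"
proof -
  obtain h g where h: "h \<in> module_hom R M N" "bij_betw h (carrier M) (carrier N)"
    and g: "g \<in> module_hom R N K" "bij_betw g (carrier N) (carrier K)"
    using assms by (auto simp: module_iso_def)
  have "g \<circ> h \<in> module_hom R M K"
    using h(1) g(1) by (intro module_homI) (auto simp: module_homD)
  then show ?thesis
    unfolding module_iso_def using bij_betw_trans[OF h(2) g(2)] by blast
qed

lemma self_module_module:
  assumes "cring R"
  shows "module R (self_module R)"
proof -
  interpret cring R by fact
  have "abelian_group (self_module R)"
    by (rule comm_group_imp_abelian_group[OF a_comm_group]) (simp_all add: self_module_def)
  then show ?thesis
    by (intro moduleI) (auto simp: self_module_def assms l_distr r_distr m_assoc)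
qed

lemma ideal_submodule_self_module:
  assumes "cring R" "ideal I R"
  shows "submodule I R (self_module R)"
proof -
  interpret I: ideal I R by fact
  interpret S: module R "self_module R"
    using assms(1) by (rule self_module_module)
  have "\<ominus>\<^bsub>self_module R\<^esub> a = \<ominus>\<^bsub>R\<^esub> a" if "a \<in> carrier R" for a
    by (rule S.M.minus_equality) (use that in \<open>auto simp: self_module_def I.l_neg\<close>)
  then show ?thesis
    by (intro S.submoduleI) (auto simp: self_module_def I.I_l_closed I.a_Hcarr I.a_subset[THEN subsetD])
qed

lemma restrict_scalars_module:
  assumes "module S M" "cring R" "\<phi> \<in> ring_hom R S"
  shows "module R (restrict_scalars \<phi> M)"
proof -
  interpret M: module S M by fact
  have "abelian_group (restrict_scalars \<phi> M)"
    by (rule comm_group_imp_abelian_group[OF M.M.a_comm_group]) (simp_all add: restrict_scalars_def)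
  then show ?thesis
    using assms(2,3) by (intro moduleI)
      (auto simp: restrict_scalars_def M.smult_l_distr M.smult_r_distr M.smult_assoc1
        ring_hom_add ring_hom_mult ring_hom_one ring_hom_closed)
qed

lemma submodule_abelian_subgroup:
  assumes "module R M" "submodule N R M"
  shows "abelian_subgroup N M"
  using assms
  by (auto intro!: abelian_subgroupI3 simp: additive_subgroup_def submodule_def module_def)

text \<open>The union over representatives in the definition has equal members, because
  \<open>N\<close> is closed under scalars; it therefore collapses to one coset.\<close>

lemma quot_module_smult:
  assumes "module R M" "submodule N R M" "a \<in> carrier R" "x \<in> carrier M"
  shows "a \<odot>\<^bsub>quot_module M N\<^esub> (N +>\<^bsub>M\<^esub> x) = N +>\<^bsub>M\<^esub> (a \<odot>\<^bsub>M\<^esub> x)"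
proof -
  interpret M: module R M by fact
  interpret N: submodule N R M by fact
  interpret abelian_subgroup N M
    using assms(1,2) by (rule submodule_abelian_subgroup)
  have "N +>\<^bsub>M\<^esub> (a \<odot>\<^bsub>M\<^esub> y) = N +>\<^bsub>M\<^esub> (a \<odot>\<^bsub>M\<^esub> x)" if "y \<in> N +>\<^bsub>M\<^esub> x" for y
  proof -
    obtain n where n: "n \<in> N" "y = n \<oplus>\<^bsub>M\<^esub> x"
      using \<open>y \<in> N +>\<^bsub>M\<^esub> x\<close> by (auto simp: a_r_coset_def')
    then have "a \<odot>\<^bsub>M\<^esub> y = a \<odot>\<^bsub>M\<^esub> n \<oplus>\<^bsub>M\<^esub> a \<odot>\<^bsub>M\<^esub> x"
      using assms(3,4) by (simp add: M.smult_r_distr)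
    then have "a \<odot>\<^bsub>M\<^esub> y \<in> N +>\<^bsub>M\<^esub> (a \<odot>\<^bsub>M\<^esub> x)"
      using n assms(3) by (auto simp: a_r_coset_def')
    then show ?thesis
      using assms(3,4) by (intro a_repr_independence'[symmetric]) simp_all
  qed
  moreover have "N +>\<^bsub>M\<^esub> x \<noteq> {}"
    using a_rcos_self[OF assms(4)] by blast
  ultimately have "(\<Union>y\<in>N +>\<^bsub>M\<^esub> x. N +>\<^bsub>M\<^esub> (a \<odot>\<^bsub>M\<^esub> y)) = N +>\<^bsub>M\<^esub> (a \<odot>\<^bsub>M\<^esub> x)"
    by (intro SUP_eq_const)
  then show ?thesis
    by (simp add: quot_module_def)
qed

lemma quot_module_module:
  assumes "module R M" "submodule N R M"
  shows "module R (quot_module M N)"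
proof -
  interpret M: module R M by fact
  interpret abelian_subgroup N M
    using assms by (rule submodule_abelian_subgroup)
  have ag: "abelian_group (quot_module M N)"
    by (rule comm_group_imp_abelian_group[OF a_factorgroup_is_comm_group])
      (simp_all add: quot_module_def A_FactGroup_def')
  have car: "carrier (quot_module M N) = (\<lambda>x. N +>\<^bsub>M\<^esub> x) ` carrier M"
    by (auto simp: quot_module_def A_RCOSETS_def')
  have add: "(N +>\<^bsub>M\<^esub> x) \<oplus>\<^bsub>quot_module M N\<^esub> (N +>\<^bsub>M\<^esub> y) = N +>\<^bsub>M\<^esub> (x \<oplus>\<^bsub>M\<^esub> y)"
    if "x \<in> carrier M" "y \<in> carrier M" for x y
    using that by (simp add: quot_module_def a_rcos_sum)
  show ?thesis
    by (rule moduleI[OF M.is_cring ag])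
      (auto simp: car quot_module_smult[OF assms] add M.smult_l_distr M.smult_r_distr M.smult_assoc1)
qed

lemma prod_module_module:
  assumes "cring R" and M: "\<And>j. j \<in> J \<Longrightarrow> module R (M j)"
  shows "module R (prod_module J M)"
proof -
  have ag: "abelian_group (M j)" if "j \<in> J" for j
    using M[OF that] by (rule module_abelian_group)
  note am = ag[THEN abelian_group.axioms(1)]
  have "abelian_group (prod_module J M)"
  proof (rule abelian_groupI)
    fix x assume x: "x \<in> carrier (prod_module J M)"
    have "(\<lambda>j\<in>J. \<ominus>\<^bsub>M j\<^esub> x j) \<in> carrier (prod_module J M)"
      using x by (auto simp: prod_module_def intro!: abelian_group.a_inv_closed[OF ag])
    moreover have "(\<lambda>j\<in>J. \<ominus>\<^bsub>M j\<^esub> x j) \<oplus>\<^bsub>prod_module J M\<^esub> x = \<zero>\<^bsub>prod_module J M\<^esub>"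
      using x by (auto simp: prod_module_def fun_eq_iff PiE_iff abelian_group.l_neg[OF ag])
    ultimately show "\<exists>y\<in>carrier (prod_module J M). y \<oplus>\<^bsub>prod_module J M\<^esub> x = \<zero>\<^bsub>prod_module J M\<^esub>"
      by blast
  next
    fix x y z
    assume "x \<in> carrier (prod_module J M)" "y \<in> carrier (prod_module J M)" "z \<in> carrier (prod_module J M)"
    then show "x \<oplus>\<^bsub>prod_module J M\<^esub> y \<oplus>\<^bsub>prod_module J M\<^esub> z = x \<oplus>\<^bsub>prod_module J M\<^esub> (y \<oplus>\<^bsub>prod_module J M\<^esub> z)"
      by (auto simp: prod_module_def fun_eq_iff PiE_iff abelian_monoid.a_assoc[OF am])
  next
    fix x y
    assume "x \<in> carrier (prod_module J M)" "y \<in> carrier (prod_module J M)"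
    then show "x \<oplus>\<^bsub>prod_module J M\<^esub> y = y \<oplus>\<^bsub>prod_module J M\<^esub> x"
      by (auto simp: prod_module_def fun_eq_iff PiE_iff abelian_monoid.a_comm[OF am])
  next
    fix x assume x: "x \<in> carrier (prod_module J M)"
    then show "\<zero>\<^bsub>prod_module J M\<^esub> \<oplus>\<^bsub>prod_module J M\<^esub> x = x"
      by (auto simp: prod_module_def fun_eq_iff PiE_iff abelian_monoid.l_zero[OF am] extensional_def)
  qed (auto simp: prod_module_def PiE_iff intro!: abelian_monoid.a_closed[OF am] abelian_monoid.zero_closed[OF am])
  then show ?thesis
    by (intro moduleI assms(1))
      (auto simp: prod_module_def fun_eq_iff PiE_iff extensional_def module.smult_closed[OF M]
        module.smult_l_distr[OF M] module.smult_r_distr[OF M] module.smult_assoc1[OF M]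
        module.smult_one[OF M])
qed

lemma sum_module_module:
  assumes "module R M" "module R N"
  shows "module R (sum_module M N)"
proof -
  interpret M: module R M by fact
  interpret N: module R N by fact
  have "abelian_group (sum_module M N)"
  proof (rule abelian_groupI)
    fix x assume "x \<in> carrier (sum_module M N)"
    then show "\<exists>y\<in>carrier (sum_module M N). y \<oplus>\<^bsub>sum_module M N\<^esub> x = \<zero>\<^bsub>sum_module M N\<^esub>"
      by (intro bexI[of _ "(\<ominus>\<^bsub>M\<^esub> fst x, \<ominus>\<^bsub>N\<^esub> snd x)"]) (auto simp: sum_module_def M.M.l_neg N.M.l_neg)
  qed (auto simp: sum_module_def M.M.a_ac N.M.a_ac)
  then show ?thesis
    by (intro moduleI M.is_cring)
      (auto simp: sum_module_def M.smult_l_distr M.smult_r_distr M.smult_assoc1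
        N.smult_l_distr N.smult_r_distr N.smult_assoc1)
qed

lemma torsion_module_module:
  assumes "module R M" and a: "a \<in> carrier R"
  shows "module R (torsion_module R a M)"
proof -
  interpret M: module R M by fact
  have pow: "a [^]\<^bsub>R\<^esub> (k + l) \<odot>\<^bsub>M\<^esub> x = a [^]\<^bsub>R\<^esub> k \<odot>\<^bsub>M\<^esub> (a [^]\<^bsub>R\<^esub> l \<odot>\<^bsub>M\<^esub> x)"
    if "x \<in> carrier M" for x and k l :: nat
    using that a by (simp add: M.smult_assoc1 M.nat_pow_mult[symmetric])
  have comm: "a [^]\<^bsub>R\<^esub> (k :: nat) \<odot>\<^bsub>M\<^esub> (b \<odot>\<^bsub>M\<^esub> x) = b \<odot>\<^bsub>M\<^esub> (a [^]\<^bsub>R\<^esub> k \<odot>\<^bsub>M\<^esub> x)"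
    if "x \<in> carrier M" "b \<in> carrier R" for x b k
    using that a by (simp add: M.smult_assoc1[symmetric] M.m_comm)
  let ?T = "{x \<in> carrier M. \<exists>k::nat. (a [^]\<^bsub>R\<^esub> k) \<odot>\<^bsub>M\<^esub> x = \<zero>\<^bsub>M\<^esub>}"
  have "submodule ?T R M"
  proof (rule M.submoduleI)
    fix x y assume "x \<in> ?T" "y \<in> ?T"
    then obtain k l :: nat where k: "a [^]\<^bsub>R\<^esub> k \<odot>\<^bsub>M\<^esub> x = \<zero>\<^bsub>M\<^esub>" "a [^]\<^bsub>R\<^esub> l \<odot>\<^bsub>M\<^esub> y = \<zero>\<^bsub>M\<^esub>"
      and xy: "x \<in> carrier M" "y \<in> carrier M" by auto
    have "a [^]\<^bsub>R\<^esub> (k + l) \<odot>\<^bsub>M\<^esub> x = \<zero>\<^bsub>M\<^esub>"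
      using xy k a pow[of x l k] by (simp add: add.commute)
    moreover have "a [^]\<^bsub>R\<^esub> (k + l) \<odot>\<^bsub>M\<^esub> y = \<zero>\<^bsub>M\<^esub>"
      using xy k a pow[of y k l] by simp
    ultimately have "a [^]\<^bsub>R\<^esub> (k + l) \<odot>\<^bsub>M\<^esub> (x \<oplus>\<^bsub>M\<^esub> y) = \<zero>\<^bsub>M\<^esub>"
      using xy a by (simp add: M.smult_r_distr)
    then show "x \<oplus>\<^bsub>M\<^esub> y \<in> ?T" using xy by blast
  next
    show "\<zero>\<^bsub>M\<^esub> \<in> ?T" by (auto intro!: exI[of _ 0])
  next
    fix b x assume b: "b \<in> carrier R" and "x \<in> ?T"
    then obtain k :: nat where "a [^]\<^bsub>R\<^esub> k \<odot>\<^bsub>M\<^esub> x = \<zero>\<^bsub>M\<^esub>" and x: "x \<in> carrier M" by auto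
    then have "a [^]\<^bsub>R\<^esub> k \<odot>\<^bsub>M\<^esub> (b \<odot>\<^bsub>M\<^esub> x) = \<zero>\<^bsub>M\<^esub>"
      using b by (simp add: comm)
    then show "b \<odot>\<^bsub>M\<^esub> x \<in> ?T"
      using b x by blast
  qed (use a in \<open>auto simp: M.smult_r_minus comm\<close>)
  then show ?thesis
    unfolding torsion_module_def using assms(1) by (rule submodule.submodule_is_module)
qed

lemma torsion_module_iso:
  assumes "module R M" "module R N" "a \<in> carrier R" "module_iso R M N"
  shows "module_iso R (torsion_module R a M) (torsion_module R a N)"
proof -
  interpret M: module R M by fact
  obtain h where h: "h \<in> module_hom R M N" and b: "bij_betw h (carrier M) (carrier N)"
    using assms by (auto simp: module_iso_def)
  have iff: "a [^]\<^bsub>R\<^esub> (k::nat) \<odot>\<^bsub>N\<^esub> h x = \<zero>\<^bsub>N\<^esub> \<longleftrightarrow> a [^]\<^bsub>R\<^esub> k \<odot>\<^bsub>M\<^esub> x = \<zero>\<^bsub>M\<^esub>" if x: "x \<in> carrier M" for k x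
  proof -
    have "a [^]\<^bsub>R\<^esub> k \<odot>\<^bsub>N\<^esub> h x = h (a [^]\<^bsub>R\<^esub> k \<odot>\<^bsub>M\<^esub> x)"
      using module_homD(3)[OF h, of "a [^]\<^bsub>R\<^esub> k" x] x assms(3) by simp
    then show ?thesis
      using module_hom_zero[OF assms(1,2) h] b x assms(3)
      by (metis M.R.nat_pow_closed M.smult_closed M.zero_closed bij_betw_def inj_onD)
  qed
  have "h \<in> module_hom R (torsion_module R a M) (torsion_module R a N)"
    using h iff by (intro module_homI) (auto simp: torsion_module_def module_homD)
  moreover have "bij_betw h (carrier (torsion_module R a M)) (carrier (torsion_module R a N))"
    using b iff by (auto simp: torsion_module_def bij_betw_def inj_on_def image_iff set_eq_iff)
       (metis+)
  ultimately show ?thesis by (auto simp: module_iso_def)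
qed

section \<open>Subquotients, images, kernels and fixed points\<close>

lemma subquotient_submodule:
  assumes "module R M" "submodule N R M" "submodule Z R M"
  shows "submodule ((\<lambda>x. N +>\<^bsub>M\<^esub> x) ` Z) R (quot_module M N)"
proof -
  interpret M: module R M by fact
  interpret Z: submodule Z R M by fact
  interpret Q: module R "quot_module M N"
    using assms(1,2) by (rule quot_module_module)
  interpret abelian_subgroup N M
    using assms(1,2) by (rule submodule_abelian_subgroup)
  note ZM = subsetD[OF M.submoduleE(1)[OF assms(3)]]
  have smult: "a \<odot>\<^bsub>quot_module M N\<^esub> (N +>\<^bsub>M\<^esub> x) \<in> (\<lambda>x. N +>\<^bsub>M\<^esub> x) ` Z"
    if "a \<in> carrier R" "x \<in> Z" for a x
    using that quot_module_smult[OF assms(1,2)] ZM by simp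
  show ?thesis
  proof (rule Q.submoduleI)
    show sub: "(+>\<^bsub>M\<^esub>) N ` Z \<subseteq> carrier (quot_module M N)"
      using ZM by (auto simp: quot_module_def A_RCOSETS_def')
    have z: "\<zero>\<^bsub>M\<^esub> \<in> Z"
      using Z.one_closed by simp
    then show "\<zero>\<^bsub>quot_module M N\<^esub> \<in> (+>\<^bsub>M\<^esub>) N ` Z"
      using M.M.a_coset_add_zero[OF a_subset] by (auto simp: quot_module_def image_iff intro!: bexI[of _ "\<zero>\<^bsub>M\<^esub>"])
    fix X assume X: "X \<in> (+>\<^bsub>M\<^esub>) N ` Z"
    \<comment> \<open>Writing negation as multiplication by -1 reduces closure under it to closure
      under scalars.\<close>
    have "\<ominus>\<^bsub>quot_module M N\<^esub> X = (\<ominus>\<^bsub>R\<^esub> \<one>\<^bsub>R\<^esub>) \<odot>\<^bsub>quot_module M N\<^esub> X"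
      using X sub by (subst Q.smult_l_minus) auto
    then show "\<ominus>\<^bsub>quot_module M N\<^esub> X \<in> (+>\<^bsub>M\<^esub>) N ` Z"
      using X smult by auto
    fix Y assume Y: "Y \<in> (+>\<^bsub>M\<^esub>) N ` Z"
    show "X \<oplus>\<^bsub>quot_module M N\<^esub> Y \<in> (+>\<^bsub>M\<^esub>) N ` Z"
      using X Y ZM M.submoduleE(5)[OF assms(3)] by (auto simp: quot_module_def a_rcos_sum)
  qed (use smult in auto)
qed

text \<open>\<open>Z\<close> need not contain \<open>N\<close>: the carrier is the image (Z + N)/N,
  as required for the cocycles of one degree modulo all coboundaries.\<close>

lemma subquotient_module:
  assumes "module R M" "submodule N R M" "submodule Z R M"
  shows "module R ((quot_module M N)\<lparr>carrier := (\<lambda>x. N +>\<^bsub>M\<^esub> x) ` Z\<rparr>)"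
  by (intro submodule.submodule_is_module subquotient_submodule quot_module_module assms)

text \<open>Both maps live on all of \<open>M\<close> and preserve \<open>N\<close>, so they descend
  to the quotient; being mutually inverse is asked only on \<open>Z\<close> and \<open>Z'\<close>.
  Degree shifts are of this kind, since they annihilate the other degrees.\<close>

lemma subquotient_iso:
  assumes M: "module R M" and N: "submodule N R M" and Z: "submodule Z R M" and Z': "submodule Z' R M"
    and h: "h \<in> module_hom R M M" "h ` N \<subseteq> N" "h ` Z \<subseteq> Z'"
    and g: "g \<in> module_hom R M M" "g ` N \<subseteq> N" "g ` Z' \<subseteq> Z"
    and gh: "\<And>x. x \<in> Z \<Longrightarrow> g (h x) = x" and hg: "\<And>x. x \<in> Z' \<Longrightarrow> h (g x) = x"
  shows "module_iso R ((quot_module M N)\<lparr>carrier := (\<lambda>x. N +>\<^bsub>M\<^esub> x) ` Z\<rparr>)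
           ((quot_module M N)\<lparr>carrier := (\<lambda>x. N +>\<^bsub>M\<^esub> x) ` Z'\<rparr>)"
proof -
  interpret M: module R M by fact
  interpret abelian_subgroup N M
    using M N by (rule submodule_abelian_subgroup)
  \<comment> \<open>The map induced on cosets, written as a union over representatives so that none
    has to be chosen.\<close>
  define H where "H k X = (\<Union>x\<in>X. N +>\<^bsub>M\<^esub> k x)" for k :: "'c \<Rightarrow> 'c" and X
  have H: "H k (N +>\<^bsub>M\<^esub> x) = N +>\<^bsub>M\<^esub> k x"
    if k: "k \<in> module_hom R M M" "k ` N \<subseteq> N" and x: "x \<in> carrier M" for k x
  proof -
    have "N +>\<^bsub>M\<^esub> k y = N +>\<^bsub>M\<^esub> k x" if "y \<in> N +>\<^bsub>M\<^esub> x" for y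
    proof -
      obtain n where n: "n \<in> N" "y = n \<oplus>\<^bsub>M\<^esub> x"
        using \<open>y \<in> N +>\<^bsub>M\<^esub> x\<close> by (auto simp: a_r_coset_def')
      then have "k y = k n \<oplus>\<^bsub>M\<^esub> k x" "k n \<in> N"
        using module_homD(2)[OF k(1)] k(2) x by auto
      then have "k y \<in> N +>\<^bsub>M\<^esub> k x"
        by (auto simp: a_r_coset_def')
      then show ?thesis
        using x module_homD(1)[OF k(1)] by (intro a_repr_independence'[symmetric]) simp_all
    qed
    moreover have "N +>\<^bsub>M\<^esub> x \<noteq> {}"
      using a_rcos_self[OF x] by blast
    ultimately show ?thesis
      unfolding H_def by (intro SUP_eq_const)
  qed
  note ZM = subsetD[OF M.submoduleE(1)[OF Z]]
  note ZM' = subsetD[OF M.submoduleE(1)[OF Z']]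
  let ?Q = "quot_module M N"
  have "H h \<in> module_hom R (?Q\<lparr>carrier := (+>\<^bsub>M\<^esub>) N ` Z\<rparr>) (?Q\<lparr>carrier := (+>\<^bsub>M\<^esub>) N ` Z'\<rparr>)"
  proof (rule module_homI; clarsimp)
    fix x assume x: "x \<in> Z"
    then show "H h (N +>\<^bsub>M\<^esub> x) \<in> (+>\<^bsub>M\<^esub>) N ` Z'"
      using ZM h by (auto simp: H)
    show "H h (a \<odot>\<^bsub>?Q\<^esub> (N +>\<^bsub>M\<^esub> x)) = a \<odot>\<^bsub>?Q\<^esub> H h (N +>\<^bsub>M\<^esub> x)" if "a \<in> carrier R" for a
      using x that ZM h(1,2) module_homD(1,3)[OF h(1)] by (simp add: H quot_module_smult[OF M N])
    fix y assume y: "y \<in> Z"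
    have "(N +>\<^bsub>M\<^esub> x) \<oplus>\<^bsub>?Q\<^esub> (N +>\<^bsub>M\<^esub> y) = N +>\<^bsub>M\<^esub> (x \<oplus>\<^bsub>M\<^esub> y)" if "x \<in> carrier M" "y \<in> carrier M" for x y
      using that by (simp add: quot_module_def a_rcos_sum)
    then show "H h ((N +>\<^bsub>M\<^esub> x) \<oplus>\<^bsub>?Q\<^esub> (N +>\<^bsub>M\<^esub> y)) = H h (N +>\<^bsub>M\<^esub> x) \<oplus>\<^bsub>?Q\<^esub> H h (N +>\<^bsub>M\<^esub> y)"
      using x y ZM h(1,2) module_homD(1,2)[OF h(1)] by (simp add: H)
  qed
  moreover have "bij_betw (H h) ((+>\<^bsub>M\<^esub>) N ` Z) ((+>\<^bsub>M\<^esub>) N ` Z')"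
  proof (rule bij_betw_byWitness[where f' = "H g"])
    show "\<forall>X\<in>(+>\<^bsub>M\<^esub>) N ` Z. H g (H h X) = X"
      using ZM h(1,2) g(1,2) gh module_homD(1)[OF h(1)] by (auto simp: H)
    show "\<forall>X\<in>(+>\<^bsub>M\<^esub>) N ` Z'. H h (H g X) = X"
      using ZM' h(1,2) g(1,2) hg module_homD(1)[OF g(1)] by (auto simp: H)
  qed (use ZM ZM' h g in \<open>auto simp: H\<close>)
  ultimately show ?thesis
    by (auto simp: module_iso_def)
qed

lemma module_hom_image_submodule:
  assumes "module R M" "module R N" and h: "h \<in> module_hom R M N"
  shows "submodule (h ` carrier M) R N"
proof -
  interpret M: module R M by fact
  interpret N: module R N by fact
  note hD = module_homD[OF h]
  show ?thesis
  proof (rule N.submoduleI)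
    show "\<zero>\<^bsub>N\<^esub> \<in> h ` carrier M"
      using module_hom_zero[OF assms] by (metis M.zero_closed imageI)
    fix y assume "y \<in> h ` carrier M"
    then obtain x where x: "x \<in> carrier M" "y = h x" by blast
    then show "\<ominus>\<^bsub>N\<^esub> y \<in> h ` carrier M"
      using additive_map_minus[OF M.M.abelian_group_axioms N.M.abelian_group_axioms hD(1,2)]
      by (metis M.a_inv_closed imageI)
    fix z assume "z \<in> h ` carrier M"
    then obtain x' where "x' \<in> carrier M" "z = h x'" by blast
    with x show "y \<oplus>\<^bsub>N\<^esub> z \<in> h ` carrier M"
      using hD(2)[of x x'] by (metis M.a_closed imageI)
  next
    fix a y assume "a \<in> carrier R" "y \<in> h ` carrier M"
    then show "a \<odot>\<^bsub>N\<^esub> y \<in> h ` carrier M"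
      using hD(3) by (metis (no_types, lifting) M.smult_closed image_iff)
  qed (use hD(1) in auto)
qed

lemma module_hom_kernel_submodule:
  assumes "module R M" "module R N" and h: "h \<in> module_hom R M N"
  shows "submodule {x \<in> carrier M. h x = \<zero>\<^bsub>N\<^esub>} R M"
proof -
  interpret M: module R M by fact
  interpret N: module R N by fact
  note hD = module_homD[OF h]
  show ?thesis
    by (rule M.submoduleI)
      (auto simp: hD module_hom_zero[OF assms]
        additive_map_minus[OF M.M.abelian_group_axioms N.M.abelian_group_axioms hD(1,2)])
qed

text \<open>With \<open>h\<close> the projection onto degree u, the fixed cocycles are those of
  degree u.\<close>

lemma submodule_fixed_points:
  assumes "module R M" "submodule Z R M" and h: "h \<in> module_hom R M M"
  shows "submodule {x \<in> Z. h x = x} R M"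
proof -
  interpret M: module R M by fact
  note hD = module_homD[OF h] and ZE = M.submoduleE[OF assms(2)]
  have Z0: "\<zero>\<^bsub>M\<^esub> \<in> Z"
    using subgroup.one_closed[OF submodule.axioms(1)[OF assms(2)]] by simp
  show ?thesis
    by (rule M.submoduleI)
      (use ZE Z0 in \<open>auto simp: hD subset_iff module_hom_zero[OF assms(1,1) h]
        additive_map_minus[OF M.M.abelian_group_axioms M.M.abelian_group_axioms hD(1,2)]\<close>)
qed

lemma submodule_zero:
  assumes "module R M"
  shows "submodule {\<zero>\<^bsub>M\<^esub>} R M"
proof -
  interpret M: module R M by fact
  show ?thesis by (rule M.submoduleI) auto
qed

lemma submodule_restrict_scalars:
  assumes "module S M" "cring R" "\<phi> \<in> ring_hom R S" "submodule K S M"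
  shows "submodule K R (restrict_scalars \<phi> M)"
proof -
  interpret M: module S M by fact
  interpret M': module R "restrict_scalars \<phi> M"
    using assms(1-3) by (rule restrict_scalars_module)
  note KE = M.submoduleE[OF assms(4)]
  have "\<ominus>\<^bsub>restrict_scalars \<phi> M\<^esub> x = \<ominus>\<^bsub>M\<^esub> x" if "x \<in> carrier M" for x
    by (rule M'.M.minus_equality) (use that in \<open>auto simp: restrict_scalars_def M.M.l_neg\<close>)
  moreover have "\<zero>\<^bsub>M\<^esub> \<in> K"
    using subgroup.one_closed[OF submodule.axioms(1)[OF assms(4)]] by simp
  ultimately show ?thesis
    using KE assms(3) by (intro M'.submoduleI) (auto simp: restrict_scalars_def ring_hom_closed subset_iff)
qed

section \<open>Counting socles\<close>

definition socle :: "('a, 'c) ring_scheme \<Rightarrow> 'a \<Rightarrow> ('a, 'm) module \<Rightarrow> 'm set" where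
  "socle R a M = {x \<in> carrier M. a \<odot>\<^bsub>M\<^esub> x = \<zero>\<^bsub>M\<^esub>}"

text \<open>The divisor \<open>y\<close> ranges over the whole module, not the socle, and may change
  with \<open>k\<close>; no compatible system of roots is asked for.\<close>

definition div_socle :: "('a, 'c) ring_scheme \<Rightarrow> 'a \<Rightarrow> ('a, 'm) module \<Rightarrow> 'm set" where
  "div_socle R a M = {x \<in> socle R a M. \<forall>k::nat. \<exists>y\<in>carrier M. a [^]\<^bsub>R\<^esub> k \<odot>\<^bsub>M\<^esub> y = x}"

lemma card_socle_iso:
  assumes "module R M" "module R N" "a \<in> carrier R" "module_iso R M N"
  shows "card (socle R a M) = card (socle R a N)"
    and "card (div_socle R a M) = card (div_socle R a N)"
proof -
  interpret M: module R M by fact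
  obtain h where h: "h \<in> module_hom R M N" and b: "bij_betw h (carrier M) (carrier N)"
    using assms by (auto simp: module_iso_def)
  have inj: "inj_on h (carrier M)" and im: "h ` carrier M = carrier N"
    using b by (auto simp: bij_betw_def)
  have iff: "c \<odot>\<^bsub>N\<^esub> h x = h y \<longleftrightarrow> c \<odot>\<^bsub>M\<^esub> x = y"
    if "c \<in> carrier R" "x \<in> carrier M" "y \<in> carrier M" for c x y
    using that inj by (simp add: module_homD(3)[OF h, symmetric] inj_on_eq_iff)
  have soc: "h x \<in> socle R a N \<longleftrightarrow> x \<in> socle R a M" if x: "x \<in> carrier M" for x
    using iff[OF assms(3) x M.zero_closed] module_hom_zero[OF assms(1,2) h] x module_homD(1)[OF h]
    by (simp add: socle_def)
  have div: "h x \<in> div_socle R a N \<longleftrightarrow> x \<in> div_socle R a M" if x: "x \<in> carrier M" for x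
    using x assms(3) by (simp add: div_socle_def soc iff flip: im)
  have "socle R a N = h ` socle R a M" "div_socle R a N = h ` div_socle R a M"
    using soc div im by (auto simp: socle_def div_socle_def image_iff set_eq_iff; metis)+
  moreover have "inj_on h (socle R a M)" "inj_on h (div_socle R a M)"
    by (rule inj_on_subset[OF inj]; auto simp: socle_def div_socle_def)+
  ultimately show "card (socle R a M) = card (socle R a N)"
    and "card (div_socle R a M) = card (div_socle R a N)"
    by (simp_all add: card_image)
qed

lemma socle_prod_module:
  "socle R a (prod_module J M) = (\<Pi>\<^sub>E j\<in>J. socle R a (M j))"
  by (auto simp: socle_def prod_module_def PiE_iff fun_eq_iff extensional_def split: if_splits)

lemma div_socle_prod_module:
  "div_socle R a (prod_module J M) = (\<Pi>\<^sub>E j\<in>J. div_socle R a (M j))"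
proof (intro subset_antisym subsetI)
  fix x assume x: "x \<in> div_socle R a (prod_module J M)"
  then have "x \<in> (\<Pi>\<^sub>E j\<in>J. socle R a (M j))"
    by (simp add: div_socle_def socle_prod_module)
  moreover have "\<exists>y\<in>carrier (M j). a [^]\<^bsub>R\<^esub> k \<odot>\<^bsub>M j\<^esub> y = x j" if j: "j \<in> J" for k :: nat and j
  proof -
    obtain y where "y \<in> (\<Pi>\<^sub>E j\<in>J. carrier (M j))" "(\<lambda>j\<in>J. a [^]\<^bsub>R\<^esub> k \<odot>\<^bsub>M j\<^esub> y j) = x"
      using x by (auto simp: div_socle_def prod_module_def)
    then show ?thesis using j by (intro bexI[of _ "y j"]) auto
  qed
  ultimately show "x \<in> (\<Pi>\<^sub>E j\<in>J. div_socle R a (M j))"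
    by (auto simp: div_socle_def PiE_iff)
next
  fix x assume x: "x \<in> (\<Pi>\<^sub>E j\<in>J. div_socle R a (M j))"
  have "\<exists>y\<in>carrier (prod_module J M). a [^]\<^bsub>R\<^esub> k \<odot>\<^bsub>prod_module J M\<^esub> y = x" for k :: nat
  proof -
    have "\<forall>j\<in>J. \<exists>y\<in>carrier (M j). a [^]\<^bsub>R\<^esub> k \<odot>\<^bsub>M j\<^esub> y = x j"
      using x by (auto simp: div_socle_def PiE_iff)
    then obtain y where "\<forall>j\<in>J. y j \<in> carrier (M j) \<and> a [^]\<^bsub>R\<^esub> k \<odot>\<^bsub>M j\<^esub> y j = x j"
      by metis
    then show ?thesis
      using x by (intro bexI[of _ "restrict y J"]) (auto simp: prod_module_def fun_eq_iff PiE_iff extensional_def)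
  qed
  moreover have "x \<in> (\<Pi>\<^sub>E j\<in>J. socle R a (M j))"
    using x by (auto simp: div_socle_def PiE_iff)
  ultimately show "x \<in> div_socle R a (prod_module J M)"
    by (simp add: div_socle_def socle_prod_module)
qed

lemma socle_sum_module: "socle R a (sum_module M N) = socle R a M \<times> socle R a N"
  by (auto simp: socle_def sum_module_def)

lemma div_socle_sum_module: "div_socle R a (sum_module M N) = div_socle R a M \<times> div_socle R a N"
  by (auto simp: div_socle_def socle_sum_module) (auto simp: sum_module_def)

text \<open>The fibres agree, so f x |-> g x is a well-defined bijection between the images. It
  serves to compare residue classes for different moduli.\<close>

lemma card_image_eqI:
  assumes "\<And>x y. x \<in> S \<Longrightarrow> y \<in> S \<Longrightarrow> f x = f y \<longleftrightarrow> g x = g y"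
  shows "card (f ` S) = card (g ` S)"
proof (rule bij_betw_same_card)
  show "bij_betw (\<lambda>z. g (SOME x. x \<in> S \<and> f x = z)) (f ` S) (g ` S)"
  proof -
    have *: "g (SOME y. y \<in> S \<and> f y = f x) = g x" if "x \<in> S" for x
      using someI[of "\<lambda>y. y \<in> S \<and> f y = f x" x] that assms by auto
    show ?thesis
      using assms by (auto simp: bij_betw_def inj_on_def * image_image)
  qed
qed

section \<open>Socles over a discrete valuation ring\<close>

context discrete_valuation_ring
begin

lemma uniformizer_pow_nonzero: "\<pi> [^] (k::nat) \<noteq> \<zero>"
  using uniformizer_closed uniformizer_nonzero by (induction k) (auto simp: integral_iff)

lemma residue_one_nonzero: "\<one> \<notin> PIdl \<pi>"
  using uniformizer_maximal cgenideal_ideal[OF uniformizer_closed]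
  by (metis ideal.one_imp_carrier maximalideal.I_notcarr)

text \<open>By maximality, pi and a together generate the unit ideal. An inverse modulo pi is enough
  where this is used, since it acts on an element killed by pi.\<close>

lemma residue_inverse:
  assumes "a \<in> carrier A" "a \<notin> PIdl \<pi>"
  obtains b c where "b \<in> carrier A" "c \<in> carrier A" "\<one> = c \<otimes> \<pi> \<oplus> b \<otimes> a"
proof -
  have i: "ideal (PIdl \<pi>) A" "ideal (PIdl a) A"
    using assms uniformizer_closed by (auto intro: cgenideal_ideal)
  then have J: "ideal (PIdl \<pi> <+>\<^bsub>A\<^esub> PIdl a) A"
    by (rule add_ideals)
  have z: "\<zero> \<in> PIdl \<pi>" "\<zero> \<in> PIdl a"
    using i by (auto intro!: additive_subgroup.zero_closed ideal.axioms(1))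
  have s: "PIdl \<pi> \<subseteq> PIdl \<pi> <+>\<^bsub>A\<^esub> PIdl a" "PIdl a \<subseteq> PIdl \<pi> <+>\<^bsub>A\<^esub> PIdl a"
    using z ideal.Icarr[OF i(1)] ideal.Icarr[OF i(2)]
    by (auto simp: set_add_def' intro!: bexI[of _ "\<zero>"])
  have "a \<in> PIdl a" using assms(1) by (rule cgenideal_self)
  then have "PIdl \<pi> <+>\<^bsub>A\<^esub> PIdl a \<noteq> PIdl \<pi>"
    using s assms(2) by blast
  then have "PIdl \<pi> <+>\<^bsub>A\<^esub> PIdl a = carrier A"
    using maximalideal.I_maximal[OF uniformizer_maximal J s(1)] ideal.Icarr[OF J] by blast
  then have "\<one> \<in> PIdl \<pi> <+>\<^bsub>A\<^esub> PIdl a" by simp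
  then show thesis
    using that by (auto simp: set_add_def' cgenideal_def)
qed

abbreviation residue_card :: nat where
  "residue_card \<equiv> card (carrier (A Quot (PIdl \<pi>)))"

text \<open>This makes exponents of powers of the residue cardinality comparable. Finiteness
  excludes the default value 0 of \<open>card\<close> on infinite sets.\<close>

lemma residue_card_gt_one:
  assumes "finite (carrier (A Quot (PIdl \<pi>)))"
  shows "1 < residue_card"
proof -
  interpret I: ideal "PIdl \<pi>" A
    using uniformizer_closed by (rule cgenideal_ideal)
  have "PIdl \<pi> +> \<zero> \<noteq> PIdl \<pi> +> \<one>"
  proof
    assume "PIdl \<pi> +> \<zero> = PIdl \<pi> +> \<one>"
    then have "\<one> \<in> PIdl \<pi>"
      using I.a_rcos_self[of \<one>] a_coset_add_zero[OF I.a_subset] by simp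
    then show False using residue_one_nonzero by contradiction
  qed
  moreover have "{PIdl \<pi> +> \<zero>, PIdl \<pi> +> \<one>} \<subseteq> carrier (A Quot (PIdl \<pi>))"
    by (auto simp: FactRing_def A_RCOSETS_def')
  ultimately show ?thesis
    using assms card_mono[of "carrier (A Quot (PIdl \<pi>))" "{PIdl \<pi> +> \<zero>, PIdl \<pi> +> \<one>}"]
    by simp
qed

lemma self_module_coset [simp]: "I +>\<^bsub>self_module A\<^esub> x = I +> x"
  by (auto simp: a_r_coset_def' self_module_def)

lemma carrier_quot_self_module:
  "carrier (quot_module (self_module A) I) = (\<lambda>x. I +> x) ` carrier A"
  by (auto simp: quot_module_def A_RCOSETS_def') (auto simp: self_module_def)

lemma PIdl_module: "a \<in> carrier A \<Longrightarrow> module A (quot_module (self_module A) (PIdl a))"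
  by (intro quot_module_module self_module_module ideal_submodule_self_module cgenideal_ideal is_cring)

lemma smult_quot_self_module:
  assumes "a \<in> carrier A" "c \<in> carrier A" "x \<in> carrier A"
  shows "a \<odot>\<^bsub>quot_module (self_module A) (PIdl c)\<^esub> (PIdl c +> x) = PIdl c +> (a \<otimes> x)"
  using quot_module_smult[OF self_module_module[OF is_cring]
      ideal_submodule_self_module[OF is_cring cgenideal_ideal[OF assms(2)]] assms(1), of x] assms(3)
  by (simp add: self_module_def flip: self_module_coset)

lemma coset_eq_iff:
  assumes "c \<in> carrier A" "x \<in> carrier A" "y \<in> carrier A"
  shows "PIdl c +> x = PIdl c +> y \<longleftrightarrow> (\<exists>d\<in>carrier A. x = d \<otimes> c \<oplus> y)"
proof -
  interpret I: ideal "PIdl c" A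
    using assms(1) by (rule cgenideal_ideal)
  have "PIdl c +> x = PIdl c +> y \<longleftrightarrow> x \<in> PIdl c +> y"
    using assms I.a_rcos_self I.a_repr_independence' by metis
  also have "\<dots> \<longleftrightarrow> (\<exists>d\<in>carrier A. x = d \<otimes> c \<oplus> y)"
    unfolding a_r_coset_def' cgenideal_def by blast
  finally show ?thesis .
qed

lemma mult_coset:
  assumes "c \<in> carrier A" "x \<in> carrier A"
  shows "PIdl c +> (c \<otimes> x) = PIdl c +> \<zero>"
  using assms by (subst coset_eq_iff) (auto intro!: bexI[of _ x] simp: m_comm)

text \<open>The class of x modulo pi^beta is killed by pi exactly when pi^(beta - 1) divides x, and
  the class of pi^(beta - 1) x modulo pi^beta corresponds to that of x modulo pi. For beta = 0 the
  quotient is zero, whence the hypothesis.\<close>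

lemma card_socle_quot:
  fixes \<beta> :: nat
  assumes "\<beta> \<ge> 1"
  shows "card (socle A \<pi> (quot_module (self_module A) (PIdl (\<pi> [^] \<beta>)))) = residue_card"
proof -
  obtain b where b: "\<beta> = Suc b" using assms by (cases \<beta>) auto
  note [simp] = uniformizer_closed
  have p: "\<pi> [^] \<beta> \<in> carrier A" by simp
  have cancel: "\<pi> [^] b \<otimes> x = \<pi> [^] b \<otimes> y \<longleftrightarrow> x = y" if "x \<in> carrier A" "y \<in> carrier A" for x y
    using that uniformizer_pow_nonzero[of b] by (simp add: m_lcancel)
  let ?Q = "quot_module (self_module A) (PIdl (\<pi> [^] \<beta>))"
  have z: "\<zero>\<^bsub>?Q\<^esub> = PIdl (\<pi> [^] \<beta>) +> \<zero>"
    using cgenideal_ideal[OF p] by (simp add: quot_module_def a_coset_add_zero ideal.Icarr subsetI)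
  have "socle A \<pi> ?Q = (\<lambda>x. PIdl (\<pi> [^] \<beta>) +> (\<pi> [^] b \<otimes> x)) ` carrier A"
  proof (intro subset_antisym subsetI)
    fix X assume "X \<in> socle A \<pi> ?Q"
    then obtain x where x: "x \<in> carrier A" "X = PIdl (\<pi> [^] \<beta>) +> x"
      and "\<pi> \<odot>\<^bsub>?Q\<^esub> (PIdl (\<pi> [^] \<beta>) +> x) = PIdl (\<pi> [^] \<beta>) +> \<zero>"
      unfolding socle_def z by (auto simp: carrier_quot_self_module)
    then obtain d where d: "d \<in> carrier A" "\<pi> \<otimes> x = d \<otimes> \<pi> [^] \<beta> \<oplus> \<zero>"
      by (auto simp: smult_quot_self_module coset_eq_iff)
    then have "\<pi> \<otimes> x = \<pi> \<otimes> (\<pi> [^] b \<otimes> d)"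
      by (simp add: b m_ac)
    then have "x = \<pi> [^] b \<otimes> d"
      using d x uniformizer_nonzero by (simp add: m_lcancel)
    then show "X \<in> (\<lambda>x. PIdl (\<pi> [^] \<beta>) +> (\<pi> [^] b \<otimes> x)) ` carrier A"
      using x d by blast
  next
    fix X assume "X \<in> (\<lambda>x. PIdl (\<pi> [^] \<beta>) +> (\<pi> [^] b \<otimes> x)) ` carrier A"
    then obtain x where x: "x \<in> carrier A" "X = PIdl (\<pi> [^] \<beta>) +> (\<pi> [^] b \<otimes> x)" by auto
    have "\<pi> \<otimes> (\<pi> [^] b \<otimes> x) = x \<otimes> \<pi> [^] \<beta> \<oplus> \<zero>"
      using x by (simp add: b m_ac)
    then have "PIdl (\<pi> [^] \<beta>) +> (\<pi> \<otimes> (\<pi> [^] b \<otimes> x)) = PIdl (\<pi> [^] \<beta>) +> \<zero>"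
      using x by (subst coset_eq_iff) auto
    then show "X \<in> socle A \<pi> ?Q"
      using x unfolding socle_def z by (auto simp: carrier_quot_self_module smult_quot_self_module)
  qed
  also have "card \<dots> = card ((\<lambda>x. PIdl \<pi> +> x) ` carrier A)"
  proof (rule card_image_eqI)
    fix x y assume xy: "x \<in> carrier A" "y \<in> carrier A"
    have "\<pi> [^] b \<otimes> x = d \<otimes> \<pi> [^] \<beta> \<oplus> \<pi> [^] b \<otimes> y \<longleftrightarrow> x = d \<otimes> \<pi> \<oplus> y" if "d \<in> carrier A" for d
    proof -
      have "d \<otimes> \<pi> [^] \<beta> \<oplus> \<pi> [^] b \<otimes> y = \<pi> [^] b \<otimes> (d \<otimes> \<pi> \<oplus> y)"
        using that xy by (simp add: b r_distr m_ac)
      then show ?thesis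
        using xy that by (simp add: cancel)
    qed
    then show "PIdl (\<pi> [^] \<beta>) +> (\<pi> [^] b \<otimes> x) = PIdl (\<pi> [^] \<beta>) +> (\<pi> [^] b \<otimes> y) \<longleftrightarrow>
      PIdl \<pi> +> x = PIdl \<pi> +> y"
      using xy by (simp add: coset_eq_iff)
  qed
  also have "(\<lambda>x. PIdl \<pi> +> x) ` carrier A = carrier (A Quot (PIdl \<pi>))"
    by (auto simp: FactRing_def A_RCOSETS_def')
  finally show ?thesis .
qed

text \<open>The exponent k = beta decides: pi^beta annihilates the quotient, so only zero is
  divisible by it.\<close>

lemma div_socle_quot:
  "div_socle A \<pi> (quot_module (self_module A) (PIdl (\<pi> [^] (\<beta>::nat)))) =
     {\<zero>\<^bsub>quot_module (self_module A) (PIdl (\<pi> [^] \<beta>))\<^esub>}" (is "div_socle A \<pi> ?Q = _")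
proof -
  note [simp] = uniformizer_closed
  have p: "\<pi> [^] \<beta> \<in> carrier A" by simp
  interpret Q: module A ?Q using p by (rule PIdl_module)
  have z: "\<zero>\<^bsub>?Q\<^esub> = PIdl (\<pi> [^] \<beta>) +> \<zero>"
    using cgenideal_ideal[OF p] by (simp add: quot_module_def a_coset_add_zero ideal.Icarr subsetI)
  have "\<pi> [^] \<beta> \<odot>\<^bsub>?Q\<^esub> y = \<zero>\<^bsub>?Q\<^esub>" if "y \<in> carrier ?Q" for y
    using that unfolding z
    by (auto simp: carrier_quot_self_module smult_quot_self_module mult_coset)
  moreover have "\<zero>\<^bsub>?Q\<^esub> \<in> div_socle A \<pi> ?Q"
    by (auto simp: div_socle_def socle_def intro!: bexI[of _ "\<zero>\<^bsub>?Q\<^esub>"])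
  moreover have "div_socle A \<pi> ?Q \<subseteq> (\<lambda>y. \<pi> [^] \<beta> \<odot>\<^bsub>?Q\<^esub> y) ` carrier ?Q"
    unfolding div_socle_def by blast
  ultimately show ?thesis by blast
qed

text \<open>The map b |-> b x from A to E is extended along multiplication by a, which is injective
  because A is a domain; the value of the extension at 1 is the required y.\<close>

lemma injective_module_divisible:
  fixes E :: "('a, 'e) module"
  assumes "injective_module A E" "a \<in> carrier A" "a \<noteq> \<zero>" "x \<in> carrier E"
  shows "\<exists>y\<in>carrier E. a \<odot>\<^bsub>E\<^esub> y = x"
proof -
  interpret E: module A E using assms(1) by (simp add: injective_module_def)
  let ?S = "self_module A"
  have f: "(\<lambda>b. a \<otimes> b) \<in> module_hom A ?S ?S"
    using assms by (intro module_homI) (auto simp: self_module_def r_distr m_ac)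
  have inj: "inj_on (\<lambda>b. a \<otimes> b) (carrier ?S)"
    using assms by (auto simp: self_module_def inj_on_def m_lcancel)
  have g: "(\<lambda>b. b \<odot>\<^bsub>E\<^esub> x) \<in> module_hom A ?S E"
    using assms by (intro module_homI) (auto simp: self_module_def E.smult_l_distr E.smult_assoc1)
  obtain h where h: "h \<in> module_hom A ?S E" "\<forall>b\<in>carrier ?S. h (a \<otimes> b) = b \<odot>\<^bsub>E\<^esub> x"
    using assms(1) self_module_module[OF is_cring] f inj g unfolding injective_module_def by blast
  have "a \<odot>\<^bsub>E\<^esub> h \<one> = h (a \<otimes> \<one>)"
    using module_homD(3)[OF h(1), of a \<one>] assms(2) by (simp add: self_module_def)
  also have "\<dots> = x"
    using bspec[OF h(2), of \<one>] assms by (simp add: self_module_def)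
  finally show ?thesis
    using module_homD(1)[OF h(1), of \<one>] by (auto simp: self_module_def)
qed

lemma injective_hull_div_socle:
  assumes "injective_hull A (quot_module (self_module A) (PIdl \<pi>)) E"
  shows "div_socle A \<pi> E = socle A \<pi> E"
  using injective_module_divisible[of E] assms uniformizer_closed uniformizer_pow_nonzero
  by (auto simp: div_socle_def injective_hull_def socle_def)

text \<open>A socle element generates a copy of the residue field, which by essentiality meets, hence
  lies in, the given copy.\<close>

lemma card_injective_hull_socle:
  assumes "injective_hull A (quot_module (self_module A) (PIdl \<pi>)) E"
  shows "card (socle A \<pi> E) = residue_card"
proof -
  let ?F = "quot_module (self_module A) (PIdl \<pi>)"
  interpret E: module A E using assms by (simp add: injective_hull_def injective_module_def)
  interpret F: module A ?F using uniformizer_closed by (rule PIdl_module)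
  note [simp] = uniformizer_closed
  obtain \<iota> where \<iota>: "\<iota> \<in> module_hom A ?F E" "inj_on \<iota> (carrier ?F)"
    and ess: "\<And>K. submodule K A E \<Longrightarrow> K \<noteq> {\<zero>\<^bsub>E\<^esub>} \<Longrightarrow> K \<inter> \<iota> ` carrier ?F \<noteq> {\<zero>\<^bsub>E\<^esub>}"
    using assms by (auto simp: injective_hull_def)
  have \<iota>0: "\<iota> \<zero>\<^bsub>?F\<^esub> = \<zero>\<^bsub>E\<^esub>"
    by (rule module_hom_zero[OF F.module_axioms E.module_axioms \<iota>(1)])
  have F0: "\<pi> \<odot>\<^bsub>?F\<^esub> x = \<zero>\<^bsub>?F\<^esub>" if "x \<in> carrier ?F" for x
  proof -
    have "\<zero>\<^bsub>?F\<^esub> = PIdl \<pi> +> \<zero>"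
      using cgenideal_ideal[OF uniformizer_closed]
      by (simp add: quot_module_def a_coset_add_zero ideal.Icarr subsetI)
    then have "?thesis \<longleftrightarrow> \<pi> \<odot>\<^bsub>?F\<^esub> x = PIdl \<pi> +> \<zero>" by (rule arg_cong)
    then show ?thesis
      using that by (auto simp only: carrier_quot_self_module smult_quot_self_module mult_coset uniformizer_closed)
  qed
  have "socle A \<pi> E = \<iota> ` carrier ?F"
  proof (intro subset_antisym subsetI)
    fix x assume "x \<in> \<iota> ` carrier ?F"
    then show "x \<in> socle A \<pi> E"
      using module_homD(1)[OF \<iota>(1)] F0 \<iota>0
      by (auto simp: socle_def simp flip: module_homD(3)[OF \<iota>(1)])
  next
    fix x assume x: "x \<in> socle A \<pi> E"
    then have xE: "x \<in> carrier E" and px: "\<pi> \<odot>\<^bsub>E\<^esub> x = \<zero>\<^bsub>E\<^esub>" by (auto simp: socle_def)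
    show "x \<in> \<iota> ` carrier ?F"
    proof (cases "x = \<zero>\<^bsub>E\<^esub>")
      case True
      then show ?thesis using \<iota>0 F.M.zero_closed by (metis imageI)
    next
      case False
      let ?K = "(\<lambda>a. a \<odot>\<^bsub>E\<^esub> x) ` carrier A"
      have K: "submodule ?K A E"
      proof (rule E.submoduleI)
        show "\<zero>\<^bsub>E\<^esub> \<in> ?K" using xE by (intro image_eqI[of _ _ \<zero>]) auto
      next
        fix y assume "y \<in> ?K"
        then obtain a where "a \<in> carrier A" "y = a \<odot>\<^bsub>E\<^esub> x" by auto
        then show "\<ominus>\<^bsub>E\<^esub> y \<in> ?K" using xE
          by (intro image_eqI[of _ _ "\<ominus> a"]) (auto simp: E.smult_l_minus)
      next
        fix y z assume "y \<in> ?K" "z \<in> ?K"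
        then obtain a b where "a \<in> carrier A" "y = a \<odot>\<^bsub>E\<^esub> x" "b \<in> carrier A" "z = b \<odot>\<^bsub>E\<^esub> x" by auto
        then show "y \<oplus>\<^bsub>E\<^esub> z \<in> ?K" using xE
          by (intro image_eqI[of _ _ "a \<oplus> b"]) (auto simp: E.smult_l_distr)
      next
        fix c y assume "c \<in> carrier A" "y \<in> ?K"
        then obtain a where "a \<in> carrier A" "y = a \<odot>\<^bsub>E\<^esub> x" "c \<in> carrier A" by auto
        then show "c \<odot>\<^bsub>E\<^esub> y \<in> ?K" using xE
          by (intro image_eqI[of _ _ "c \<otimes> a"]) (auto simp: E.smult_assoc1)
      qed (use xE in auto)
      have "x \<in> ?K" using xE by (intro image_eqI[of _ _ \<one>]) auto
      then have "?K \<inter> \<iota> ` carrier ?F \<noteq> {\<zero>\<^bsub>E\<^esub>}"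
        using False by (intro ess K) auto
      moreover have "\<zero>\<^bsub>E\<^esub> \<in> ?K \<inter> \<iota> ` carrier ?F"
        using subgroup.one_closed[OF submodule.axioms(1)[OF K]] imageI[OF F.M.zero_closed, of \<iota>] \<iota>0
        by simp
      ultimately have "\<not> ?K \<inter> \<iota> ` carrier ?F \<subseteq> {\<zero>\<^bsub>E\<^esub>}"
        by blast
      then obtain y where y: "y \<in> ?K" "y \<in> \<iota> ` carrier ?F" "y \<noteq> \<zero>\<^bsub>E\<^esub>"
        by blast
      then obtain a z where a: "a \<in> carrier A" "z \<in> carrier ?F" "a \<odot>\<^bsub>E\<^esub> x = \<iota> z" "a \<odot>\<^bsub>E\<^esub> x \<noteq> \<zero>\<^bsub>E\<^esub>"
        by auto
      \<comment> \<open>Since pi kills x but a x is not zero, a is invertible modulo pi; an inverse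
        b gives x = b (a x), which lies in the image of \<iota>.\<close>
      have "a \<notin> PIdl \<pi>"
      proof
        assume "a \<in> PIdl \<pi>"
        then obtain c where "c \<in> carrier A" "a = c \<otimes> \<pi>" by (auto simp: cgenideal_def)
        then show False using a(4) xE px by (simp add: E.smult_assoc1)
      qed
      then obtain b c where bc: "b \<in> carrier A" "c \<in> carrier A" "\<one> = c \<otimes> \<pi> \<oplus> b \<otimes> a"
        using a(1) residue_inverse by blast
      have "x = \<one> \<odot>\<^bsub>E\<^esub> x" using xE by simp
      also have "\<dots> = b \<odot>\<^bsub>E\<^esub> \<iota> z"
        unfolding bc(3) using bc(1,2) a(1) xE px
        by (simp add: E.smult_l_distr E.smult_assoc1 flip: a(3))
      also have "\<dots> = \<iota> (b \<odot>\<^bsub>?F\<^esub> z)"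
        using module_homD(3)[OF \<iota>(1) bc(1) a(2)] by simp
      finally show ?thesis
        using bc(1) a(2) by blast
    qed
  qed
  then have "card (socle A \<pi> E) = card (carrier ?F)"
    using \<iota>(2) by (simp add: card_image)
  also have "carrier ?F = carrier (A Quot (PIdl \<pi>))"
    by (auto simp: carrier_quot_self_module FactRing_def A_RCOSETS_def')
  finally show ?thesis .
qed

text \<open>Both counts are multiplicative over direct summands. A copy of E contributes the residue
  cardinality to each of them; a cyclic summand contributes 1 to the divisible count and the residue
  cardinality to the full one.\<close>

lemma decomposition_unique:
  fixes E :: "('a, 'e) module" and l l' t t' :: nat and \<beta> \<beta>' :: "nat \<Rightarrow> nat"
  assumes fin: "finite (carrier (A Quot (PIdl \<pi>)))"
    and E: "injective_hull A (quot_module (self_module A) (PIdl \<pi>)) E"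
    and \<beta>: "\<And>j. j \<in> {1..t} \<Longrightarrow> \<beta> j \<ge> 1" "\<And>j. j \<in> {1..t'} \<Longrightarrow> \<beta>' j \<ge> 1"
    and iso: "module_iso A
      (sum_module (prod_module {1..l} (\<lambda>_. E))
        (prod_module {1..t} (\<lambda>j. quot_module (self_module A) (PIdl (\<pi> [^] \<beta> j)))))
      (sum_module (prod_module {1..l'} (\<lambda>_. E))
        (prod_module {1..t'} (\<lambda>j. quot_module (self_module A) (PIdl (\<pi> [^] \<beta>' j)))))"
  shows "l = l' \<and> t = t'"
proof -
  define D :: "nat \<Rightarrow> nat \<Rightarrow> (nat \<Rightarrow> nat) \<Rightarrow> ('a, (nat \<Rightarrow> 'e) \<times> (nat \<Rightarrow> 'a set)) module" where
    "D l t \<beta> = sum_module (prod_module {1..l} (\<lambda>_. E))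
        (prod_module {1..t} (\<lambda>j. quot_module (self_module A) (PIdl (\<pi> [^] \<beta> j))))" for l t \<beta>
  have "module A E"
    using E by (simp add: injective_hull_def injective_module_def)
  then have D: "module A (D l t \<beta>)" for l t \<beta>
    unfolding D_def using uniformizer_closed
    by (intro sum_module_module prod_module_module PIdl_module is_cring) auto
  have "card (div_socle A \<pi> (D l t \<beta>)) = residue_card ^ l"
    if "\<And>j. j \<in> {1..t} \<Longrightarrow> \<beta> j \<ge> 1" for l t \<beta>
    unfolding D_def
    by (simp add: div_socle_sum_module div_socle_prod_module card_cartesian_product card_PiE
        injective_hull_div_socle[OF E] card_injective_hull_socle[OF E] div_socle_quot)
  moreover have "card (socle A \<pi> (D l t \<beta>)) = residue_card ^ l * residue_card ^ t"
    if "\<And>j. j \<in> {1..t} \<Longrightarrow> \<beta> j \<ge> 1" for l t \<beta>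
    unfolding D_def using that
    by (simp add: socle_sum_module socle_prod_module card_cartesian_product card_PiE
        card_injective_hull_socle[OF E] card_socle_quot)
  ultimately have eq: "residue_card ^ l = residue_card ^ l'"
    "residue_card ^ l * residue_card ^ t = residue_card ^ l' * residue_card ^ t'"
    using card_socle_iso[OF D D uniformizer_closed iso[folded D_def]] \<beta> by auto
  then show ?thesis
    using residue_card_gt_one[OF fin] by simp
qed

end

section \<open>Polynomials\<close>

text \<open>Stated for products so that the version for sums is inherited below, where it flattens
  the nested sums in the associativity of polynomial multiplication.\<close>

lemma (in comm_monoid) finprod_Sigma:
  assumes "finite J" "\<And>j. j \<in> J \<Longrightarrow> finite (B j)"
    and "\<And>j b. j \<in> J \<Longrightarrow> b \<in> B j \<Longrightarrow> f j b \<in> carrier G"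
  shows "(\<Otimes>j\<in>J. \<Otimes>b\<in>B j. f j b) = finprod G (\<lambda>(j, b). f j b) (Sigma J B)"
proof -
  have "(\<Otimes>p\<in>\<Union>((\<lambda>j. Pair j ` B j) ` J). case_prod f p) = (\<Otimes>j\<in>J. \<Otimes>p\<in>Pair j ` B j. case_prod f p)"
    by (rule finprod_UN_disjoint) (use assms in \<open>auto simp: pairwise_def disjnt_def\<close>)
  also have "(\<Union>j\<in>J. Pair j ` B j) = Sigma J B" by auto
  also have "(\<Otimes>j\<in>J. \<Otimes>p\<in>Pair j ` B j. case_prod f p) = (\<Otimes>j\<in>J. \<Otimes>b\<in>B j. f j b)"
  proof (rule finprod_cong')
    fix j assume j: "j \<in> J"
    show "(\<Otimes>p\<in>Pair j ` B j. case_prod f p) = (\<Otimes>b\<in>B j. f j b)"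
      using assms(3)[OF j] by (subst finprod_reindex) (auto simp: inj_on_def)
  qed (use assms in auto)
  finally show ?thesis by simp
qed

context abelian_monoid
begin
lemmas finsum_Sigma = add.finprod_Sigma
end

definition splittings :: "('n::finite \<Rightarrow> nat) \<Rightarrow> (('n \<Rightarrow> nat) \<times> ('n \<Rightarrow> nat)) set" where
  "splittings m = {(a, b). \<forall>i. a i + b i = m i}"

lemma mem_splittings: "(a, b) \<in> splittings m \<longleftrightarrow> (\<forall>i. a i + b i = m i)"
  by (simp add: splittings_def)

lemma finite_splittings [simp]: "finite (splittings m)"
proof (rule finite_subset)
  let ?S = "\<Pi>\<^sub>E i\<in>UNIV. {..m i}"
  show "splittings m \<subseteq> ?S \<times> ?S"
    by (auto simp: splittings_def PiE_iff) (metis le_add1, metis le_add2)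
  show "finite (?S \<times> ?S)"
    by (intro finite_cartesian_product finite_PiE) auto
qed

context cring
begin

lemma mpoly_carrier_iff:
  "f \<in> carrier (mpoly_ring R) \<longleftrightarrow> (\<forall>m. f m \<in> carrier R) \<and> finite {m. f m \<noteq> \<zero>}"
  by (auto simp: mpoly_ring_def)

lemma mpoly_coeff_closed [intro]: "f \<in> carrier (mpoly_ring R) \<Longrightarrow> f m \<in> carrier R"
  by (auto simp: mpoly_carrier_iff)

lemma mpoly_add: "f \<oplus>\<^bsub>mpoly_ring R\<^esub> g = (\<lambda>m. f m \<oplus> g m)"
  by (simp add: mpoly_ring_def)

lemma mpoly_zero: "\<zero>\<^bsub>mpoly_ring R\<^esub> = (\<lambda>_. \<zero>)"
  by (simp add: mpoly_ring_def)

lemma mpoly_mult: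
  "f \<otimes>\<^bsub>mpoly_ring R\<^esub> g = (\<lambda>m. finsum R (\<lambda>(a, b). f a \<otimes> g b) (splittings m))"
  by (simp add: mpoly_ring_def splittings_def)

text \<open>The support of the product lies in the sumset of the two supports, which is
  finite.\<close>

lemma mpoly_mult_closed:
  assumes f: "f \<in> carrier (mpoly_ring R)" and g: "g \<in> carrier (mpoly_ring R)"
  shows "f \<otimes>\<^bsub>mpoly_ring R\<^esub> g \<in> carrier (mpoly_ring R)"
proof -
  let ?S = "{m. f m \<noteq> \<zero>}" and ?T = "{m. g m \<noteq> \<zero>}"
  have "finsum R (\<lambda>(a, b). f a \<otimes> g b) (splittings m) = \<zero>"
    if m: "m \<notin> (\<lambda>(a, b) i. a i + b i) ` (?S \<times> ?T)" for m
  proof (rule add.finprod_one_eqI, clarify)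
    fix a b assume "(a, b) \<in> splittings m"
    then have "m = (\<lambda>i. a i + b i)" by (auto simp: splittings_def)
    then have "f a = \<zero> \<or> g b = \<zero>" using m by auto
    then show "f a \<otimes> g b = \<zero>"
      using f g by (auto simp: mpoly_carrier_iff)
  qed
  then have "{m. finsum R (\<lambda>(a, b). f a \<otimes> g b) (splittings m) \<noteq> \<zero>} \<subseteq> (\<lambda>(a, b) i. a i + b i) ` (?S \<times> ?T)"
    by blast
  moreover have "finite ((\<lambda>(a, b) i. a i + b i) ` (?S \<times> ?T))"
    using f g by (auto simp: mpoly_carrier_iff)
  ultimately have "finite {m. finsum R (\<lambda>(a, b). f a \<otimes> g b) (splittings m) \<noteq> \<zero>}"
    by (rule finite_subset)
  moreover have "finsum R (\<lambda>(a, b). f a \<otimes> g b) (splittings m) \<in> carrier R" for m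
    using f g by (intro finsum_closed) (auto simp: mpoly_carrier_iff)
  ultimately show ?thesis
    by (simp add: mpoly_carrier_iff mpoly_mult)
qed

lemma mpoly_mult_comm:
  assumes f: "f \<in> carrier (mpoly_ring R)" and g: "g \<in> carrier (mpoly_ring R)"
  shows "f \<otimes>\<^bsub>mpoly_ring R\<^esub> g = g \<otimes>\<^bsub>mpoly_ring R\<^esub> f"
proof -
  have "finsum R (\<lambda>(a, b). f a \<otimes> g b) (splittings m) = (finsum R (\<lambda>(a, b). g a \<otimes> f b) (splittings m))" for m
  proof -
    have s: "splittings m = prod.swap ` splittings m"
      by (auto simp: splittings_def image_iff add.commute)
    have "(finsum R (\<lambda>(a, b). g a \<otimes> f b) (prod.swap ` splittings m)) = (\<Oplus>p\<in>splittings m. case prod.swap p of (a, b) \<Rightarrow> g a \<otimes> f b)"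
      using f g by (intro finsum_reindex) (auto simp: mpoly_carrier_iff)
    also have "\<dots> = (finsum R (\<lambda>(a, b). f a \<otimes> g b) (splittings m))"
      using f g by (intro finsum_cong') (auto simp: mpoly_carrier_iff m_comm)
    finally show ?thesis using s by simp
  qed
  then show ?thesis by (simp add: mpoly_mult)
qed

text \<open>Both sides are sums over the triples (a, b, c) with a + b + c = m; the left one groups
  them by x = a + b, the right one by x = b + c.\<close>

lemma mpoly_mult_assoc:
  assumes f: "f \<in> carrier (mpoly_ring R)" and g: "g \<in> carrier (mpoly_ring R)"
    and h: "h \<in> carrier (mpoly_ring R)"
  shows "f \<otimes>\<^bsub>mpoly_ring R\<^esub> g \<otimes>\<^bsub>mpoly_ring R\<^esub> h = f \<otimes>\<^bsub>mpoly_ring R\<^esub> (g \<otimes>\<^bsub>mpoly_ring R\<^esub> h)"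
proof -
  note [simp] = mpoly_coeff_closed[OF f] mpoly_coeff_closed[OF g] mpoly_coeff_closed[OF h]
  have "(finsum R (\<lambda>(x, c). (finsum R (\<lambda>(a, b). f a \<otimes> g b) (splittings x)) \<otimes> h c) (splittings m)) =
      (finsum R (\<lambda>(a, x). f a \<otimes> (finsum R (\<lambda>(b, c). g b \<otimes> h c) (splittings x))) (splittings m))" for m
  proof -
    let ?S = "SIGMA p:splittings m. splittings (fst p)"
    let ?T = "SIGMA p:splittings m. splittings (snd p)"
    \<comment> \<open>Passes from one grouping to the other. The intermediate sum x is determined by
      the triple, which makes this map injective.\<close>
    let ?re = "\<lambda>((x, c), (a, b)). ((a, (\<lambda>i. b i + c i)), (b, c))"
    have "(finsum R (\<lambda>(x, c). (finsum R (\<lambda>(a, b). f a \<otimes> g b) (splittings x)) \<otimes> h c) (splittings m)) =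
        (\<Oplus>p\<in>splittings m. \<Oplus>q\<in>splittings (fst p). f (fst q) \<otimes> g (snd q) \<otimes> h (snd p))"
      by (intro finsum_cong') (auto simp: finsum_ldistr case_prod_unfold intro!: finsum_closed)
    also have "\<dots> = (finsum R (\<lambda>(p, q). f (fst q) \<otimes> g (snd q) \<otimes> h (snd p)) ?S)"
      by (intro finsum_Sigma) auto
    also have "\<dots> = (\<Oplus>t\<in>?S. case ?re t of (p, q) \<Rightarrow> f (fst p) \<otimes> (g (fst q) \<otimes> h (snd q)))"
      by (intro finsum_cong') (auto simp: m_assoc)
    also have "\<dots> = (finsum R (\<lambda>(p, q). f (fst p) \<otimes> (g (fst q) \<otimes> h (snd q))) (?re ` ?S))"
    proof (rule finsum_reindex[symmetric])
      show "inj_on ?re ?S"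
        by (auto simp: inj_on_def splittings_def fun_eq_iff)
    qed auto
    also have "?re ` ?S = ?T"
    proof (intro subset_antisym subsetI)
      fix t assume "t \<in> ?T"
      then obtain a x b c where t: "t = ((a, x), (b, c))" "(a, x) \<in> splittings m" "(b, c) \<in> splittings x"
        by auto
      then show "t \<in> ?re ` ?S"
        by (intro image_eqI[of _ _ "(((\<lambda>i. a i + b i), c), (a, b))"])
          (auto simp: splittings_def add.assoc fun_eq_iff)
    qed (auto simp: splittings_def add.assoc[symmetric])
    also have "(finsum R (\<lambda>(p, q). f (fst p) \<otimes> (g (fst q) \<otimes> h (snd q))) ?T) =
        (\<Oplus>p\<in>splittings m. \<Oplus>q\<in>splittings (snd p). f (fst p) \<otimes> (g (fst q) \<otimes> h (snd q)))"
      by (intro finsum_Sigma[symmetric]) auto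
    also have "\<dots> = (finsum R (\<lambda>(a, x). f a \<otimes> (finsum R (\<lambda>(b, c). g b \<otimes> h c) (splittings x))) (splittings m))"
      by (intro finsum_cong') (auto simp: finsum_rdistr case_prod_unfold intro!: finsum_closed)
    finally show ?thesis .
  qed
  then show ?thesis by (simp add: mpoly_mult)
qed

lemma mterm_closed [simp, intro]: "a \<in> carrier R \<Longrightarrow> mterm R a m \<in> carrier (mpoly_ring R)"
  by (auto simp: mpoly_carrier_iff mterm_def intro: finite_subset[of _ "{m}"])

text \<open>The only splitting of k that can contribute is (m, k - m), and it exists only when m
  \<le> k; the guard also rules out truncated subtraction.\<close>

lemma mterm_mult_coeff:
  assumes a: "a \<in> carrier R" and g: "g \<in> carrier (mpoly_ring R)"
  shows "(mterm R a m \<otimes>\<^bsub>mpoly_ring R\<^esub> g) k =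
    (if \<forall>i. m i \<le> k i then a \<otimes> g (\<lambda>i. k i - m i) else \<zero>)"
proof -
  note [simp] = mpoly_coeff_closed[OF g] a
  show ?thesis
  proof (cases "\<forall>i. m i \<le> k i")
    case True
    have "(finsum R (\<lambda>(x, y). mterm R a m x \<otimes> g y) (splittings k)) =
      (\<Oplus>p\<in>splittings k. if (m, \<lambda>i. k i - m i) = p then a \<otimes> g (snd p) else \<zero>)"
    proof (rule finsum_cong')
      fix p assume p: "p \<in> splittings k"
      have "snd p = (\<lambda>i. k i - m i)" if "fst p = m"
        using p that by (auto simp: splittings_def fun_eq_iff) (metis diff_add_inverse)
      then show "(case p of (x, y) \<Rightarrow> mterm R a m x \<otimes> g y) =
        (if (m, \<lambda>i. k i - m i) = p then a \<otimes> g (snd p) else \<zero>)"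
        by (cases p) (auto simp: mterm_def)
    qed auto
    also have "\<dots> = a \<otimes> g (snd (m, \<lambda>i. k i - m i))"
      by (rule finsum_singleton) (use True in \<open>auto simp: mem_splittings\<close>)
    finally show ?thesis using True by (simp add: mpoly_mult)
  next
    case False
    have "(finsum R (\<lambda>(x, y). mterm R a m x \<otimes> g y) (splittings k)) = \<zero>"
    proof (rule add.finprod_one_eqI, clarify)
      fix x y assume "(x, y) \<in> splittings k"
      then have "x \<noteq> m" using False by (auto simp: splittings_def) (metis le_add1)
      then show "mterm R a m x \<otimes> g y = \<zero>" by (simp add: mterm_def)
    qed
    then show ?thesis using False by (subst if_not_P) (simp_all add: mpoly_mult)
  qed
qed

lemma mpoly_abelian_group: "abelian_group (mpoly_ring R :: (('n::finite \<Rightarrow> nat) \<Rightarrow> 'a) ring)"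
proof (rule abelian_groupI)
  fix f g :: "('n \<Rightarrow> nat) \<Rightarrow> 'a" assume f: "f \<in> carrier (mpoly_ring R)" and g: "g \<in> carrier (mpoly_ring R)"
  have "finite {m. f m \<oplus> g m \<noteq> \<zero>}"
    by (rule finite_subset[of _ "{m. f m \<noteq> \<zero>} \<union> {m. g m \<noteq> \<zero>}"])
      (use f g in \<open>auto simp: mpoly_carrier_iff\<close>)
  then show "f \<oplus>\<^bsub>mpoly_ring R\<^esub> g \<in> carrier (mpoly_ring R)"
    using f g by (auto simp: mpoly_carrier_iff mpoly_add)
next
  fix f :: "('n \<Rightarrow> nat) \<Rightarrow> 'a" assume f: "f \<in> carrier (mpoly_ring R)"
  have "finite {m. \<ominus> f m \<noteq> \<zero>}"
    by (rule finite_subset[of _ "{m. f m \<noteq> \<zero>}"]) (use f in \<open>auto simp: mpoly_carrier_iff\<close>)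
  then show "\<exists>g\<in>carrier (mpoly_ring R). g \<oplus>\<^bsub>mpoly_ring R\<^esub> f = \<zero>\<^bsub>mpoly_ring R\<^esub>"
    using f by (intro bexI[of _ "\<lambda>m. \<ominus> f m"])
      (auto simp: mpoly_carrier_iff mpoly_add mpoly_zero l_neg)
qed (auto simp: mpoly_carrier_iff mpoly_add mpoly_zero a_ac)

lemma mpoly_one: "\<one>\<^bsub>mpoly_ring R\<^esub> = mterm R \<one> (\<lambda>_. 0)"
  by (simp add: mpoly_ring_def mterm_def)

lemma mpoly_l_one:
  assumes "f \<in> carrier (mpoly_ring R)"
  shows "\<one>\<^bsub>mpoly_ring R\<^esub> \<otimes>\<^bsub>mpoly_ring R\<^esub> f = f"
  using mpoly_coeff_closed[OF assms] by (simp add: fun_eq_iff mpoly_one mterm_mult_coeff assms)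

lemma mpoly_l_distr:
  assumes f: "f \<in> carrier (mpoly_ring R)" and g: "g \<in> carrier (mpoly_ring R)"
    and h: "h \<in> carrier (mpoly_ring R)"
  shows "(f \<oplus>\<^bsub>mpoly_ring R\<^esub> g) \<otimes>\<^bsub>mpoly_ring R\<^esub> h =
    f \<otimes>\<^bsub>mpoly_ring R\<^esub> h \<oplus>\<^bsub>mpoly_ring R\<^esub> g \<otimes>\<^bsub>mpoly_ring R\<^esub> h"
proof -
  note [simp] = mpoly_coeff_closed[OF f] mpoly_coeff_closed[OF g] mpoly_coeff_closed[OF h]
  have "(finsum R (\<lambda>(a, b). (f a \<oplus> g a) \<otimes> h b) (splittings m)) =
    (finsum R (\<lambda>(a, b). f a \<otimes> h b) (splittings m)) \<oplus> (finsum R (\<lambda>(a, b). g a \<otimes> h b) (splittings m))" for m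
    by (subst finsum_addf[symmetric]) (auto simp: l_distr case_prod_unfold intro!: finsum_cong')
  then show ?thesis
    by (simp add: mpoly_mult mpoly_add)
qed

lemma mpoly_cring: "cring (mpoly_ring R)"
proof (rule cringI)
  show "comm_monoid (mpoly_ring R)"
    by (rule comm_monoidI)
      (auto simp: mpoly_mult_closed mpoly_one mpoly_mult_assoc mpoly_l_one[unfolded mpoly_one]
        intro: mpoly_mult_comm)
qed (auto simp: mpoly_abelian_group mpoly_l_distr)

lemma mterm_mult:
  assumes "a \<in> carrier R" "b \<in> carrier R"
  shows "mterm R a m \<otimes>\<^bsub>mpoly_ring R\<^esub> mterm R b k = mterm R (a \<otimes> b) (\<lambda>i. m i + k i)"
proof
  fix j
  have *: "(\<forall>i. m i \<le> j i) \<and> (\<lambda>i. j i - m i) = k \<longleftrightarrow> j = (\<lambda>i. m i + k i)"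
    by (auto simp: fun_eq_iff) (metis le_add_diff_inverse)
  show "(mterm R a m \<otimes>\<^bsub>mpoly_ring R\<^esub> mterm R b k) j = mterm R (a \<otimes> b) (\<lambda>i. m i + k i) j"
    using assms * by (auto simp: mterm_mult_coeff) (auto simp: mterm_def)
qed

lemma mterm_pow:
  assumes "a \<in> carrier R"
  shows "mterm R a m [^]\<^bsub>mpoly_ring R\<^esub> (k::nat) = mterm R (a [^] k) (\<lambda>i. k * m i)"
  by (induction k) (use assms in \<open>auto simp: mpoly_one mterm_mult add.commute\<close>)

lemma mterm_finprod:
  assumes "finite J" "\<And>j. j \<in> J \<Longrightarrow> a j \<in> carrier R"
  shows "(\<Otimes>\<^bsub>mpoly_ring R\<^esub>j\<in>J. mterm R (a j) (m j)) = mterm R (\<Otimes>j\<in>J. a j) (\<lambda>i. \<Sum>j\<in>J. m j i)"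
proof -
  interpret P: cring "mpoly_ring R" by (rule mpoly_cring)
  show ?thesis using assms
  proof (induction J)
    case empty
    then show ?case by (simp add: mpoly_one)
  next
    case (insert j J)
    have "finprod R a J \<in> carrier R" using insert.prems by (intro finprod_closed) auto
    with insert show ?case
      by (simp add: P.finprod_insert finprod_insert Pi_iff mterm_mult)
  qed
qed

lemma mconst_ring_hom: "mconst R \<in> ring_hom R (mpoly_ring R)"
  by (rule ring_hom_memI) (auto simp: mconst_def mterm_mult mpoly_one mpoly_add, auto simp: mterm_def)

text \<open>Coefficients and terms with integral exponents, which vanish where an exponent is negative.\<close>

definition zcoeff :: "(('n::finite \<Rightarrow> nat) \<Rightarrow> 'a) \<Rightarrow> ('n \<Rightarrow> int) \<Rightarrow> 'a" where
  "zcoeff f w = (if \<forall>i. 0 \<le> w i then f (\<lambda>i. nat (w i)) else \<zero>)"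

definition zterm :: "'a \<Rightarrow> ('n::finite \<Rightarrow> int) \<Rightarrow> ('n \<Rightarrow> nat) \<Rightarrow> 'a" where
  "zterm c w = (\<lambda>m. if \<forall>i. int (m i) = w i then c else \<zero>)"

lemma zcoeff_closed [simp, intro]: "f \<in> carrier (mpoly_ring R) \<Longrightarrow> zcoeff f w \<in> carrier R"
  by (auto simp: zcoeff_def)

lemma zterm_closed [simp, intro]:
  assumes "c \<in> carrier R"
  shows "zterm c w \<in> carrier (mpoly_ring R)"
proof -
  have "{m. zterm c w m \<noteq> \<zero>} \<subseteq> {\<lambda>i. nat (w i)}"
    by (auto simp: zterm_def fun_eq_iff split: if_splits) (metis nat_int)
  then have "finite {m. zterm c w m \<noteq> \<zero>}"
    by (rule finite_subset) simp
  then show ?thesis using assms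
    by (auto simp: mpoly_carrier_iff) (auto simp: zterm_def)
qed

lemma zcoeff_add:
  assumes "f \<in> carrier (mpoly_ring R)" "g \<in> carrier (mpoly_ring R)"
  shows "zcoeff (f \<oplus>\<^bsub>mpoly_ring R\<^esub> g) w = zcoeff f w \<oplus> zcoeff g w"
  by (simp add: zcoeff_def mpoly_add)

lemma zterm_add:
  assumes "a \<in> carrier R" "b \<in> carrier R"
  shows "zterm (a \<oplus> b) w = zterm a w \<oplus>\<^bsub>mpoly_ring R\<^esub> zterm b w"
  using assms by (auto simp: zterm_def mpoly_add fun_eq_iff)

text \<open>If w has a negative coordinate i, then w i + m i is below m i, so the product has no
  such coefficient and both sides vanish. Hence w is arbitrary, in contrast to
  \<open>mterm_mult_zterm\<close>.\<close>

lemma zcoeff_mterm_mult: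
  assumes "a \<in> carrier R" "f \<in> carrier (mpoly_ring R)"
  shows "zcoeff (mterm R a m \<otimes>\<^bsub>mpoly_ring R\<^esub> f) (\<lambda>i. w i + int (m i)) = a \<otimes> zcoeff f w"
proof (cases "\<forall>i. 0 \<le> w i")
  case True
  then have "\<forall>i. m i \<le> nat (w i + int (m i))" "(\<lambda>i. nat (w i + int (m i)) - m i) = (\<lambda>i. nat (w i))"
    "\<forall>i. 0 \<le> w i + int (m i)"
    by (auto simp: nat_add_distrib)
  then show ?thesis using assms True by (simp add: zcoeff_def mterm_mult_coeff)
next
  case False
  then have "\<not> (\<forall>i. m i \<le> nat (w i + int (m i)))" if "\<forall>i. 0 \<le> w i + int (m i)"
    using that by (metis add_le_cancel_right add_0 le_nat_iff)
  then show ?thesis using assms False by (auto simp: zcoeff_def mterm_mult_coeff)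
qed

text \<open>Multiplication by X^m may turn a negative exponent into a non-negative one; the left
  side is then zero while the right side is a genuine term. The sign condition excludes this, and it
  is the origin of \<open>shiftable\<close>.\<close>

lemma mterm_mult_zterm:
  assumes "a \<in> carrier R" "c \<in> carrier R" "c \<noteq> \<zero> \<Longrightarrow> \<forall>i. 0 \<le> w i"
  shows "mterm R a m \<otimes>\<^bsub>mpoly_ring R\<^esub> zterm c w = zterm (a \<otimes> c) (\<lambda>i. w i + int (m i))"
proof (cases "c = \<zero>")
  case True
  have "zterm \<zero> w \<in> carrier (mpoly_ring R)" by simp
  with True show ?thesis using assms(1) by (simp add: fun_eq_iff mterm_mult_coeff) (simp add: zterm_def)
next
  case False
  then have w: "\<forall>i. 0 \<le> w i" using assms(3) by blast
  show ?thesis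
  proof
    fix k
    have "(\<forall>i. m i \<le> k i) \<and> (\<forall>i. int (k i - m i) = w i) \<longleftrightarrow> (\<forall>i. int (k i) = w i + int (m i))"
    proof -
      have "m i \<le> k i \<and> int (k i - m i) = w i \<longleftrightarrow> int (k i) = w i + int (m i)" for i
        using w[rule_format, of i] by linarith
      then show ?thesis by blast
    qed
    then show "(mterm R a m \<otimes>\<^bsub>mpoly_ring R\<^esub> zterm c w) k = zterm (a \<otimes> c) (\<lambda>i. w i + int (m i)) k"
      using assms(1,2) by (simp add: mterm_mult_coeff) (auto simp: zterm_def)
  qed
qed

lemma homogeneous_zterm: "c \<in> carrier R \<Longrightarrow> homogeneous R w (zterm c w)"
  unfolding homogeneous_def using zterm_closed[of c w] by (auto simp: zterm_def split: if_splits)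

text \<open>A homogeneous polynomial is a single term, or zero if w has a negative coordinate, so
  one coefficient recovers it.\<close>

lemma zterm_zcoeff:
  assumes "homogeneous R w f"
  shows "zterm (zcoeff f w) w = f"
proof
  fix m
  show "zterm (zcoeff f w) w m = f m"
  proof (cases "\<forall>i. int (m i) = w i")
    case True
    then have "m = (\<lambda>i. nat (w i))" "\<forall>i. 0 \<le> w i"
      by (metis nat_int, metis of_nat_0_le_iff)
    then show ?thesis using True by (simp add: zterm_def zcoeff_def)
  next
    case False
    then have "f m = \<zero>" using assms by (auto simp: homogeneous_def)
    then show ?thesis using False by (auto simp: zterm_def)
  qed
qed

lemma zcoeff_zterm: "\<forall>i. 0 \<le> w i \<Longrightarrow> zcoeff (zterm c w) w = c"
  by (simp add: zcoeff_def zterm_def)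

end

section \<open>Localizations\<close>

lemma (in cring) mem_loc_frac:
  "(s, l) \<in> loc_frac R f r k \<longleftrightarrow>
    s \<in> carrier R \<and> (\<exists>m::nat. f [^] m \<otimes> (f [^] l \<otimes> r) = f [^] m \<otimes> (f [^] k \<otimes> s))"
  by (simp add: loc_frac_def)

lemma (in cring) carrier_localization_iff:
  "X \<in> carrier (localization R f) \<longleftrightarrow> (\<exists>r\<in>carrier R. \<exists>k. X = loc_frac R f r k)"
  by (auto simp: localization_def)

locale cring_localization = cring R for R (structure) +
  fixes f
  assumes f_closed [simp]: "f \<in> carrier R"
begin

lemma pow_add: "f [^] (k + l :: nat) = f [^] k \<otimes> f [^] l"
  by (simp add: nat_pow_mult)

text \<open>In an arbitrary commutative ring, transitivity costs a larger multiplier: f^m and f^n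
  come from the two equations, and f^k allows r to be eliminated between them.\<close>

lemma loc_frac_trans:
  fixes j k l m n :: nat
  assumes r: "r \<in> carrier R" and s: "s \<in> carrier R" and t: "t \<in> carrier R"
    and m: "f [^] m \<otimes> (f [^] l \<otimes> r) = f [^] m \<otimes> (f [^] k \<otimes> s)"
    and n: "f [^] n \<otimes> (f [^] j \<otimes> r) = f [^] n \<otimes> (f [^] k \<otimes> t)"
  shows "f [^] (m + n + k) \<otimes> (f [^] j \<otimes> s) = f [^] (m + n + k) \<otimes> (f [^] l \<otimes> t)"
proof -
  have "f [^] (m + n + k) \<otimes> (f [^] j \<otimes> s) = f [^] n \<otimes> f [^] j \<otimes> (f [^] m \<otimes> (f [^] k \<otimes> s))"
    using s by (simp add: pow_add m_ac)
  also have "\<dots> = f [^] m \<otimes> f [^] l \<otimes> (f [^] n \<otimes> (f [^] j \<otimes> r))"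
    unfolding m[symmetric] using r by (simp add: m_ac)
  also have "\<dots> = f [^] (m + n + k) \<otimes> (f [^] l \<otimes> t)"
    unfolding n using t by (simp add: pow_add m_ac)
  finally show ?thesis .
qed

lemma loc_frac_self: "r \<in> carrier R \<Longrightarrow> (r, k) \<in> loc_frac R f r k"
  by (auto simp: mem_loc_frac)

lemma loc_frac_eq_iff_mem:
  assumes r: "r \<in> carrier R" and s: "s \<in> carrier R"
  shows "loc_frac R f r k = loc_frac R f s l \<longleftrightarrow> (s, l) \<in> loc_frac R f r k"
proof
  assume "(s, l) \<in> loc_frac R f r k"
  then obtain m :: nat where m: "f [^] m \<otimes> (f [^] l \<otimes> r) = f [^] m \<otimes> (f [^] k \<otimes> s)"
    by (auto simp: mem_loc_frac)
  show "loc_frac R f r k = loc_frac R f s l"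
  proof (intro subset_antisym subrelI)
    fix t j assume "(t, j) \<in> loc_frac R f r k"
    then show "(t, j) \<in> loc_frac R f s l"
      using loc_frac_trans[OF r s _ m] unfolding mem_loc_frac by blast
  next
    fix t j assume "(t, j) \<in> loc_frac R f s l"
    then show "(t, j) \<in> loc_frac R f r k"
      using loc_frac_trans[OF s r _ m[symmetric]] unfolding mem_loc_frac by blast
  qed
qed (use loc_frac_self[OF s] in simp)

lemma loc_frac_eqI:
  assumes "r \<in> carrier R" "s \<in> carrier R" "f [^] (m::nat) \<otimes> (f [^] l \<otimes> r) = f [^] m \<otimes> (f [^] k \<otimes> s)"
  shows "loc_frac R f r k = loc_frac R f s l"
  using assms by (subst loc_frac_eq_iff_mem) (auto simp: mem_loc_frac)

lemma loc_frac_eqI0: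
  assumes "r \<in> carrier R" "s \<in> carrier R" "f [^] l \<otimes> r = f [^] k \<otimes> s"
  shows "loc_frac R f r k = loc_frac R f s l"
  using assms by (intro loc_frac_eqI[of _ _ 0]) auto

lemma loc_frac_closed [simp, intro]: "r \<in> carrier R \<Longrightarrow> loc_frac R f r k \<in> carrier (localization R f)"
  by (auto simp: carrier_localization_iff)

text \<open>Raises the exponent of the denominator; this is how fractions are brought above the
  threshold of the degree shifts.\<close>

lemma loc_frac_expand:
  assumes "r \<in> carrier R"
  shows "loc_frac R f r k = loc_frac R f (f [^] (n::nat) \<otimes> r) (n + k)"
  using assms by (intro loc_frac_eqI0) (simp_all add: pow_add m_ac)

text \<open>The operations on fractions are unions over representatives. Once independence of the
  representative is known, such a union collapses to its value at the given one.\<close>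

lemma UN_loc_frac:
  assumes "r \<in> carrier R" "\<And>s l. (s, l) \<in> loc_frac R f r k \<Longrightarrow> G s l = G r k"
  shows "(\<Union>(s, l)\<in>loc_frac R f r k. G s l) = G r k"
proof (rule SUP_eq_const)
  show "loc_frac R f r k \<noteq> {}" using loc_frac_self[OF assms(1)] by blast
qed (use assms(2) in auto)

lemma loc_add:
  assumes r: "r \<in> carrier R" and s: "s \<in> carrier R"
  shows "loc_frac R f r k \<oplus>\<^bsub>localization R f\<^esub> loc_frac R f s l =
    loc_frac R f (f [^] l \<otimes> r \<oplus> f [^] k \<otimes> s) (k + l)"
proof -
  define G where "G r k s l = loc_frac R f (f [^] l \<otimes> r \<oplus> f [^] k \<otimes> s) (k + l)" for r s and k l :: nat
  have G: "G r' k' s' l' = G r k s l"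
    if r': "(r', k') \<in> loc_frac R f r k" and s': "(s', l') \<in> loc_frac R f s l" for r' k' s' l'
  proof -
    obtain m n :: nat where c: "r' \<in> carrier R" "s' \<in> carrier R"
      and m: "f [^] m \<otimes> (f [^] k' \<otimes> r) = f [^] m \<otimes> (f [^] k \<otimes> r')"
      and n: "f [^] n \<otimes> (f [^] l' \<otimes> s) = f [^] n \<otimes> (f [^] l \<otimes> s')"
      using r' s' by (auto simp: mem_loc_frac)
    \<comment> \<open>The multiplier f^(m + n) lets each of the two summands absorb its own
      equation, \<open>m\<close> or \<open>n\<close>.\<close>
    have "f [^] (m + n) \<otimes> (f [^] (k + l) \<otimes> (f [^] l' \<otimes> r' \<oplus> f [^] k' \<otimes> s')) =
        f [^] n \<otimes> f [^] l \<otimes> f [^] l' \<otimes> (f [^] m \<otimes> (f [^] k \<otimes> r')) \<oplus>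
        f [^] m \<otimes> f [^] k \<otimes> f [^] k' \<otimes> (f [^] n \<otimes> (f [^] l \<otimes> s'))"
      using c by (simp add: pow_add r_distr m_ac)
    also have "\<dots> = f [^] (m + n) \<otimes> (f [^] (k' + l') \<otimes> (f [^] l \<otimes> r \<oplus> f [^] k \<otimes> s))"
      unfolding m[symmetric] n[symmetric] using r s by (simp add: pow_add r_distr m_ac)
    finally show ?thesis
      unfolding G_def using c r s by (intro loc_frac_eqI) auto
  qed
  have "loc_frac R f r k \<oplus>\<^bsub>localization R f\<^esub> loc_frac R f s l =
      (\<Union>(r', k')\<in>loc_frac R f r k. \<Union>(s', l')\<in>loc_frac R f s l. G r' k' s' l')"
    by (simp add: localization_def G_def)
  also have "\<dots> = (\<Union>(r', k')\<in>loc_frac R f r k. G r' k' s l)"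
  proof (intro SUP_cong refl, clarify)
    fix r' k' assume r': "(r', k') \<in> loc_frac R f r k"
    show "(\<Union>(s', l')\<in>loc_frac R f s l. G r' k' s' l') = G r' k' s l"
      by (rule UN_loc_frac[OF s]) (simp add: G[OF r'] loc_frac_self[OF s])
  qed
  also have "\<dots> = G r k s l"
    by (rule UN_loc_frac[OF r]) (simp add: G loc_frac_self[OF s])
  finally show ?thesis by (simp add: G_def)
qed

lemma loc_smult:
  assumes r: "r \<in> carrier R" and a: "a \<in> carrier R"
  shows "a \<odot>\<^bsub>localization R f\<^esub> loc_frac R f r k = loc_frac R f (a \<otimes> r) k"
proof -
  have "loc_frac R f (a \<otimes> s) l = loc_frac R f (a \<otimes> r) k" if sl: "(s, l) \<in> loc_frac R f r k" for s l
  proof -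
    obtain m :: nat where s: "s \<in> carrier R" and m: "f [^] m \<otimes> (f [^] l \<otimes> r) = f [^] m \<otimes> (f [^] k \<otimes> s)"
      using sl by (auto simp: mem_loc_frac)
    have "f [^] m \<otimes> (f [^] k \<otimes> (a \<otimes> s)) = a \<otimes> (f [^] m \<otimes> (f [^] k \<otimes> s))"
      using s a by (simp add: m_ac)
    also have "\<dots> = f [^] m \<otimes> (f [^] l \<otimes> (a \<otimes> r))"
      unfolding m[symmetric] using r a by (simp add: m_ac)
    finally show ?thesis using s r a by (intro loc_frac_eqI) auto
  qed
  then show ?thesis
    using UN_loc_frac[OF r, of k "\<lambda>s l. loc_frac R f (a \<otimes> s) l"] by (simp add: localization_def)
qed

text \<open>The exponent is free, so that zero can be given whatever denominator an addition
  produces.\<close>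

lemma loc_zero: "\<zero>\<^bsub>localization R f\<^esub> = loc_frac R f \<zero> k"
  unfolding localization_def by (simp, rule loc_frac_eqI0) auto

lemma localization_cases:
  assumes "X \<in> carrier (localization R f)"
  obtains r k where "r \<in> carrier R" "X = loc_frac R f r k"
  using assms by (auto simp: carrier_localization_iff)

lemma localization_abelian_group: "abelian_group (localization R f)"
proof (rule abelian_groupI)
  fix X Y assume "X \<in> carrier (localization R f)" "Y \<in> carrier (localization R f)"
  then obtain r k s l where [simp]: "r \<in> carrier R" "s \<in> carrier R"
    and X: "X = loc_frac R f r k" and Y: "Y = loc_frac R f s l"
    by (metis localization_cases)
  show "X \<oplus>\<^bsub>localization R f\<^esub> Y \<in> carrier (localization R f)"
    unfolding X Y by (simp add: loc_add)
  show "X \<oplus>\<^bsub>localization R f\<^esub> Y = Y \<oplus>\<^bsub>localization R f\<^esub> X"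
    unfolding X Y by (simp add: loc_add a_comm add.commute)
  fix Z assume "Z \<in> carrier (localization R f)"
  then obtain t j where [simp]: "t \<in> carrier R" and Z: "Z = loc_frac R f t j"
    by (metis localization_cases)
  have "f [^] j \<otimes> (f [^] l \<otimes> r \<oplus> f [^] k \<otimes> s) \<oplus> f [^] (k + l) \<otimes> t =
      f [^] (l + j) \<otimes> r \<oplus> f [^] k \<otimes> (f [^] j \<otimes> s \<oplus> f [^] l \<otimes> t)"
    by (simp add: pow_add r_distr m_ac a_ac)
  then show "X \<oplus>\<^bsub>localization R f\<^esub> Y \<oplus>\<^bsub>localization R f\<^esub> Z = X \<oplus>\<^bsub>localization R f\<^esub> (Y \<oplus>\<^bsub>localization R f\<^esub> Z)"
    unfolding X Y Z by (simp add: loc_add add.assoc)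
next
  show "\<zero>\<^bsub>localization R f\<^esub> \<in> carrier (localization R f)"
    by (simp add: loc_zero[of 0])
next
  fix X assume "X \<in> carrier (localization R f)"
  then obtain r k where [simp]: "r \<in> carrier R" and X: "X = loc_frac R f r k"
    by (metis localization_cases)
  show "\<zero>\<^bsub>localization R f\<^esub> \<oplus>\<^bsub>localization R f\<^esub> X = X"
    unfolding X by (simp add: loc_zero[of 0] loc_add)
  have "loc_frac R f (\<ominus> r) k \<oplus>\<^bsub>localization R f\<^esub> X = \<zero>\<^bsub>localization R f\<^esub>"
    unfolding X loc_zero[of "k + k"] by (simp add: loc_add r_distr[symmetric] l_neg)
  then show "\<exists>Y\<in>carrier (localization R f). Y \<oplus>\<^bsub>localization R f\<^esub> X = \<zero>\<^bsub>localization R f\<^esub>"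
    by (intro bexI[of _ "loc_frac R f (\<ominus> r) k"]) auto
qed

lemma localization_module: "module R (localization R f)"
proof (rule moduleI[OF is_cring localization_abelian_group])
  fix X assume "X \<in> carrier (localization R f)"
  then obtain r k where [simp]: "r \<in> carrier R" and X: "X = loc_frac R f r k"
    by (metis localization_cases)
  show "\<one> \<odot>\<^bsub>localization R f\<^esub> X = X"
    unfolding X by (simp add: loc_smult)
  fix a assume [simp]: "a \<in> carrier R"
  show "a \<odot>\<^bsub>localization R f\<^esub> X \<in> carrier (localization R f)"
    unfolding X by (simp add: loc_smult)
  fix b assume [simp]: "b \<in> carrier R"
  show "(a \<oplus> b) \<odot>\<^bsub>localization R f\<^esub> X =
    a \<odot>\<^bsub>localization R f\<^esub> X \<oplus>\<^bsub>localization R f\<^esub> b \<odot>\<^bsub>localization R f\<^esub> X"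
    unfolding X by (simp add: loc_smult loc_add)
      (rule loc_frac_eqI0; simp add: pow_add l_distr r_distr m_ac)
  show "(a \<otimes> b) \<odot>\<^bsub>localization R f\<^esub> X = a \<odot>\<^bsub>localization R f\<^esub> (b \<odot>\<^bsub>localization R f\<^esub> X)"
    unfolding X by (simp add: loc_smult m_assoc)
next
  fix a X Y assume [simp]: "a \<in> carrier R" and "X \<in> carrier (localization R f)" "Y \<in> carrier (localization R f)"
  then obtain r k s l where [simp]: "r \<in> carrier R" "s \<in> carrier R"
    and X: "X = loc_frac R f r k" and Y: "Y = loc_frac R f s l"
    by (metis localization_cases)
  show "a \<odot>\<^bsub>localization R f\<^esub> (X \<oplus>\<^bsub>localization R f\<^esub> Y) =
    a \<odot>\<^bsub>localization R f\<^esub> X \<oplus>\<^bsub>localization R f\<^esub> a \<odot>\<^bsub>localization R f\<^esub> Y"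
    unfolding X Y by (simp add: loc_smult loc_add r_distr m_ac)
qed

lemma loc_map_frac:
  assumes r: "r \<in> carrier R" and h: "h \<in> carrier R"
  shows "loc_map R f h (loc_frac R f r k) = loc_frac R (f \<otimes> h) (h [^] k \<otimes> r) k"
proof -
  interpret fh: cring_localization R "f \<otimes> h"
    by unfold_locales (simp add: h)
  have "loc_frac R (f \<otimes> h) (h [^] l \<otimes> s) l = loc_frac R (f \<otimes> h) (h [^] k \<otimes> r) k"
    if sl: "(s, l) \<in> loc_frac R f r k" for s l
  proof -
    obtain m :: nat where s: "s \<in> carrier R" and m: "f [^] m \<otimes> (f [^] l \<otimes> r) = f [^] m \<otimes> (f [^] k \<otimes> s)"
      using sl by (auto simp: mem_loc_frac)
    have "(f \<otimes> h) [^] m \<otimes> ((f \<otimes> h) [^] k \<otimes> (h [^] l \<otimes> s)) =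
        h [^] m \<otimes> h [^] k \<otimes> h [^] l \<otimes> (f [^] m \<otimes> (f [^] k \<otimes> s))"
      using s h by (simp add: nat_pow_distrib m_ac)
    also have "\<dots> = (f \<otimes> h) [^] m \<otimes> ((f \<otimes> h) [^] l \<otimes> (h [^] k \<otimes> r))"
      unfolding m[symmetric] using r h by (simp add: nat_pow_distrib m_ac)
    finally show ?thesis using s r h by (intro fh.loc_frac_eqI) auto
  qed
  then show ?thesis
    using UN_loc_frac[OF r, of k "\<lambda>s l. loc_frac R (f \<otimes> h) (h [^] l \<otimes> s) l"] by (simp add: loc_map_def)
qed

lemma loc_map_hom:
  assumes h: "h \<in> carrier R"
  shows "loc_map R f h \<in> module_hom R (localization R f) (localization R (f \<otimes> h))"
proof -
  interpret fh: cring_localization R "f \<otimes> h"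
    by unfold_locales (simp add: h)
  show ?thesis
  proof (rule module_homI)
    fix X assume "X \<in> carrier (localization R f)"
    then obtain r k where [simp]: "r \<in> carrier R" and X: "X = loc_frac R f r k"
      by (metis localization_cases)
    show "loc_map R f h X \<in> carrier (localization R (f \<otimes> h))"
      unfolding X using h by (simp add: loc_map_frac)
    show "loc_map R f h (a \<odot>\<^bsub>localization R f\<^esub> X) = a \<odot>\<^bsub>localization R (f \<otimes> h)\<^esub> loc_map R f h X"
      if "a \<in> carrier R" for a
      unfolding X using h that by (simp add: loc_smult loc_map_frac fh.loc_smult m_ac)
    fix Y assume "Y \<in> carrier (localization R f)"
    then obtain s l where [simp]: "s \<in> carrier R" and Y: "Y = loc_frac R f s l"
      by (metis localization_cases)
    show "loc_map R f h (X \<oplus>\<^bsub>localization R f\<^esub> Y) =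
      loc_map R f h X \<oplus>\<^bsub>localization R (f \<otimes> h)\<^esub> loc_map R f h Y"
      unfolding X Y using h
      by (simp add: loc_add loc_map_frac fh.loc_add nat_pow_distrib nat_pow_mult[symmetric] r_distr m_ac)
  qed
qed

end

section \<open>Cech complexes\<close>

locale cech_complex = cring R for R (structure) +
  fixes gs :: "'a list"
  assumes gs_closed: "set gs \<subseteq> carrier R"
begin

abbreviation elt where "elt \<equiv> cech_elt R gs"
abbreviation L where "L S \<equiv> localization R (elt S)"
abbreviation \<delta> where "\<delta> T j \<equiv> loc_map R (elt (T - {j})) (gs ! j)"

lemma nth_closed: "j < length gs \<Longrightarrow> gs ! j \<in> carrier R"
  using gs_closed by auto

lemma elt_closed: "S \<subseteq> {..<length gs} \<Longrightarrow> elt S \<in> carrier R"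
  unfolding cech_elt_def by (intro finprod_closed) (auto intro: nth_closed)

lemma cring_localization_elt: "S \<subseteq> {..<length gs} \<Longrightarrow> cring_localization R (elt S)"
  by unfold_locales (rule elt_closed)

text \<open>Identifies the target of \<open>loc_map\<close> with the localization at T, so that all
  faces of a cochain at T land in one module.\<close>

lemma elt_remove:
  assumes "T \<subseteq> {..<length gs}" "j \<in> T"
  shows "elt (T - {j}) \<otimes> gs ! j = elt T"
proof -
  have "finite T" using assms(1) finite_subset by blast
  have "elt (insert j (T - {j})) = gs ! j \<otimes> elt (T - {j})"
    unfolding cech_elt_def using assms \<open>finite T\<close>
    by (intro finprod_insert) (auto intro: nth_closed)
  moreover have "insert j (T - {j}) = T" using assms by auto
  moreover have "elt (T - {j}) \<in> carrier R" "gs ! j \<in> carrier R"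
    using assms by (auto intro: elt_closed nth_closed)
  ultimately show ?thesis by (simp add: m_comm)
qed

lemma index_subset: "S \<in> cech_index gs i \<Longrightarrow> S \<subseteq> {..<length gs}"
  by (simp add: cech_index_def)

lemma index_finite: "S \<in> cech_index gs i \<Longrightarrow> finite S"
  using index_subset finite_subset by blast

lemma index_remove: "T \<in> cech_index gs (Suc i) \<Longrightarrow> j \<in> T \<Longrightarrow> T - {j} \<in> cech_index gs i"
  using index_finite[of T] by (auto simp: cech_index_def)

lemma L_module: "S \<in> cech_index gs i \<Longrightarrow> module R (L S)"
  using cring_localization.localization_module[OF cring_localization_elt[OF index_subset]] .

lemma L_abelian_group: "S \<in> cech_index gs i \<Longrightarrow> abelian_group (L S)"
  using L_module module_abelian_group by blast

lemma cech_module_module: "module R (cech_module R gs i)"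
  unfolding cech_module_def by (intro prod_module_module L_module is_cring)

lemma \<delta>_hom:
  assumes "T \<in> cech_index gs (Suc i)" "j \<in> T"
  shows "\<delta> T j \<in> module_hom R (L (T - {j})) (L T)"
proof -
  have T: "T \<subseteq> {..<length gs}" using assms(1) by (rule index_subset)
  interpret cring_localization R "elt (T - {j})"
    using index_subset[OF index_remove[OF assms]] by (rule cring_localization_elt)
  show ?thesis
    using loc_map_hom[of "gs ! j"] nth_closed[of j] T assms(2) by (simp add: elt_remove[OF T] subset_iff)
qed

lemma carrier_cech_module: "carrier (cech_module R gs i) = (\<Pi>\<^sub>E S\<in>cech_index gs i. carrier (L S))"
  by (simp add: cech_module_def prod_module_def)

definition face :: "nat set \<Rightarrow> nat \<Rightarrow> (nat set \<Rightarrow> ('a \<times> nat) set) \<Rightarrow> ('a \<times> nat) set" where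
  "face T j x = (if even (card {k \<in> T. k < j}) then \<delta> T j (x (T - {j})) else \<ominus>\<^bsub>L T\<^esub> \<delta> T j (x (T - {j})))"

lemma cech_diff_eq: "cech_diff R gs i x = (\<lambda>T\<in>cech_index gs (Suc i). \<Oplus>\<^bsub>L T\<^esub>j\<in>T. face T j x)"
  by (simp add: cech_diff_def face_def Let_def)

lemma \<delta>_closed:
  assumes "x \<in> carrier (cech_module R gs i)" "T \<in> cech_index gs (Suc i)" "j \<in> T"
  shows "\<delta> T j (x (T - {j})) \<in> carrier (L T)"
  using assms index_remove[OF assms(2,3)]
  by (intro module_homD(1)[OF \<delta>_hom[OF assms(2,3)]]) (auto simp: carrier_cech_module)

lemma face_closed:
  assumes "x \<in> carrier (cech_module R gs i)" "T \<in> cech_index gs (Suc i)" "j \<in> T"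
  shows "face T j x \<in> carrier (L T)"
  using \<delta>_closed[OF assms] abelian_group.a_inv_closed[OF L_abelian_group[OF assms(2)]]
  by (simp add: face_def)

lemma cech_diff_closed:
  assumes "x \<in> carrier (cech_module R gs i)"
  shows "cech_diff R gs i x \<in> carrier (cech_module R gs (Suc i))"
proof -
  have "(\<Oplus>\<^bsub>L T\<^esub>j\<in>T. face T j x) \<in> carrier (L T)" if T: "T \<in> cech_index gs (Suc i)" for T
  proof -
    interpret LT: abelian_group "L T" using T by (rule L_abelian_group)
    show ?thesis using face_closed[OF assms T] by (intro LT.finsum_closed) auto
  qed
  then show ?thesis by (simp add: cech_diff_eq carrier_cech_module)
qed

lemma cech_diff_add:
  assumes x: "x \<in> carrier (cech_module R gs i)" and y: "y \<in> carrier (cech_module R gs i)"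
  shows "cech_diff R gs i (x \<oplus>\<^bsub>cech_module R gs i\<^esub> y) =
    cech_diff R gs i x \<oplus>\<^bsub>cech_module R gs (Suc i)\<^esub> cech_diff R gs i y"
proof -
  have "(\<Oplus>\<^bsub>L T\<^esub>j\<in>T. face T j (x \<oplus>\<^bsub>cech_module R gs i\<^esub> y)) =
      (\<Oplus>\<^bsub>L T\<^esub>j\<in>T. face T j x) \<oplus>\<^bsub>L T\<^esub> (\<Oplus>\<^bsub>L T\<^esub>j\<in>T. face T j y)"
    if T: "T \<in> cech_index gs (Suc i)" for T
  proof -
    interpret LT: abelian_group "L T" using T by (rule L_abelian_group)
    have "face T j (x \<oplus>\<^bsub>cech_module R gs i\<^esub> y) = face T j x \<oplus>\<^bsub>L T\<^esub> face T j y" if j: "j \<in> T" for j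
    proof -
      have "(x \<oplus>\<^bsub>cech_module R gs i\<^esub> y) (T - {j}) = x (T - {j}) \<oplus>\<^bsub>L (T - {j})\<^esub> y (T - {j})"
        using index_remove[OF T j] by (simp add: cech_module_def prod_module_def)
      moreover have "x (T - {j}) \<in> carrier (L (T - {j}))" "y (T - {j}) \<in> carrier (L (T - {j}))"
        using x y index_remove[OF T j] by (auto simp: carrier_cech_module)
      ultimately have "\<delta> T j ((x \<oplus>\<^bsub>cech_module R gs i\<^esub> y) (T - {j})) =
          \<delta> T j (x (T - {j})) \<oplus>\<^bsub>L T\<^esub> \<delta> T j (y (T - {j}))"
        using module_homD(2)[OF \<delta>_hom[OF T j]] by simp
      then show ?thesis
        using \<delta>_closed[OF x T j] \<delta>_closed[OF y T j] by (simp add: face_def LT.minus_add)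
    qed
    then have "(\<Oplus>\<^bsub>L T\<^esub>j\<in>T. face T j (x \<oplus>\<^bsub>cech_module R gs i\<^esub> y)) =
        (\<Oplus>\<^bsub>L T\<^esub>j\<in>T. face T j x \<oplus>\<^bsub>L T\<^esub> face T j y)"
      using face_closed[OF x T] face_closed[OF y T] by (intro LT.finsum_cong') auto
    also have "\<dots> = (\<Oplus>\<^bsub>L T\<^esub>j\<in>T. face T j x) \<oplus>\<^bsub>L T\<^esub> (\<Oplus>\<^bsub>L T\<^esub>j\<in>T. face T j y)"
      using face_closed[OF x T] face_closed[OF y T] by (intro LT.finsum_addf) auto
    finally show ?thesis .
  qed
  then show ?thesis
    by (simp add: cech_diff_eq fun_eq_iff cech_module_def prod_module_def)
qed

text \<open>Scalar multiplication and the degree shifts are both families of this kind.\<close>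

lemma cech_diff_natural:
  assumes closed: "\<And>S X. S \<subseteq> {..<length gs} \<Longrightarrow> X \<in> carrier (L S) \<Longrightarrow> \<theta> S X \<in> carrier (L S)"
    and add: "\<And>S X Y. S \<subseteq> {..<length gs} \<Longrightarrow> X \<in> carrier (L S) \<Longrightarrow> Y \<in> carrier (L S) \<Longrightarrow>
      \<theta> S (X \<oplus>\<^bsub>L S\<^esub> Y) = \<theta> S X \<oplus>\<^bsub>L S\<^esub> \<theta> S Y"
    and natural: "\<And>T j X. T \<subseteq> {..<length gs} \<Longrightarrow> j \<in> T \<Longrightarrow> X \<in> carrier (L (T - {j})) \<Longrightarrow>
      \<theta> T (\<delta> T j X) = \<delta> T j (\<theta> (T - {j}) X)"
    and x: "x \<in> carrier (cech_module R gs i)"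
  shows "cech_diff R gs i (\<lambda>S\<in>cech_index gs i. \<theta> S (x S)) =
    (\<lambda>T\<in>cech_index gs (Suc i). \<theta> T (cech_diff R gs i x T))"
proof
  fix T
  show "cech_diff R gs i (\<lambda>S\<in>cech_index gs i. \<theta> S (x S)) T =
    (\<lambda>T\<in>cech_index gs (Suc i). \<theta> T (cech_diff R gs i x T)) T"
  proof (cases "T \<in> cech_index gs (Suc i)")
    case T: True
    then have sub: "T \<subseteq> {..<length gs}" by (rule index_subset)
    interpret LT: abelian_group "L T" using T by (rule L_abelian_group)
    note ag = LT.abelian_group_axioms
    have "face T j (\<lambda>S\<in>cech_index gs i. \<theta> S (x S)) = \<theta> T (face T j x)" if j: "j \<in> T" for j
    proof -
      have "x (T - {j}) \<in> carrier (L (T - {j}))"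
        using x index_remove[OF T j] by (auto simp: carrier_cech_module)
      then show ?thesis
        using index_remove[OF T j] \<delta>_closed[OF x T j]
          additive_map_minus[OF ag ag closed[OF sub] add[OF sub]]
        by (simp add: face_def natural[OF sub j])
    qed
    then have "(\<Oplus>\<^bsub>L T\<^esub>j\<in>T. face T j (\<lambda>S\<in>cech_index gs i. \<theta> S (x S))) = (\<Oplus>\<^bsub>L T\<^esub>j\<in>T. \<theta> T (face T j x))"
      using closed[OF sub] face_closed[OF x T] by (intro LT.finsum_cong') auto
    also have "\<dots> = \<theta> T (\<Oplus>\<^bsub>L T\<^esub>j\<in>T. face T j x)"
      using index_finite[OF T] face_closed[OF x T]
      by (intro additive_map_finsum[OF ag ag closed[OF sub] add[OF sub], symmetric]) auto
    finally show ?thesis using T by (simp add: cech_diff_eq)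
  qed (simp add: cech_diff_eq)
qed

lemma cech_diff_hom: "cech_diff R gs i \<in> module_hom R (cech_module R gs i) (cech_module R gs (Suc i))"
proof (rule module_homI)
  fix a x assume a: "a \<in> carrier R" and x: "x \<in> carrier (cech_module R gs i)"
  have "cech_diff R gs i (\<lambda>S\<in>cech_index gs i. a \<odot>\<^bsub>L S\<^esub> x S) =
    (\<lambda>T\<in>cech_index gs (Suc i). a \<odot>\<^bsub>L T\<^esub> cech_diff R gs i x T)"
  proof (rule cech_diff_natural[OF _ _ _ x])
    fix T j X assume "T \<subseteq> {..<length gs}" "j \<in> T" "X \<in> carrier (L (T - {j}))"
    \<comment> \<open>\<open>\<delta>_hom\<close> is indexed by the cochain degree, while naturality
      is asked for every T; the degree is recovered as the cardinality of T without j.\<close>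
    moreover from calculation have "finite T" using finite_subset by blast
    with calculation have "T \<in> cech_index gs (Suc (card (T - {j})))"
      using card_Suc_Diff1[of T j] unfolding cech_index_def by auto
    ultimately show "a \<odot>\<^bsub>L T\<^esub> \<delta> T j X = \<delta> T j (a \<odot>\<^bsub>L (T - {j})\<^esub> X)"
      using module_homD(3)[OF \<delta>_hom a] by simp
  next
    fix S X Y assume S: "S \<subseteq> {..<length gs}" and XY: "X \<in> carrier (L S)" "Y \<in> carrier (L S)"
    interpret module R "L S"
      using cring_localization.localization_module[OF cring_localization_elt[OF S]] .
    show "a \<odot>\<^bsub>L S\<^esub> (X \<oplus>\<^bsub>L S\<^esub> Y) = a \<odot>\<^bsub>L S\<^esub> X \<oplus>\<^bsub>L S\<^esub> a \<odot>\<^bsub>L S\<^esub> Y"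
      using a XY by (rule smult_r_distr)
  next
    fix S X assume S: "S \<subseteq> {..<length gs}" and X: "X \<in> carrier (L S)"
    interpret module R "L S"
      using cring_localization.localization_module[OF cring_localization_elt[OF S]] .
    show "a \<odot>\<^bsub>L S\<^esub> X \<in> carrier (L S)"
      using a X by (rule smult_closed)
  qed
  then show "cech_diff R gs i (a \<odot>\<^bsub>cech_module R gs i\<^esub> x) = a \<odot>\<^bsub>cech_module R gs (Suc i)\<^esub> cech_diff R gs i x"
    by (simp add: cech_module_def prod_module_def)
qed (auto simp: cech_diff_closed cech_diff_add)

lemma cech_cocycles_submodule: "submodule (cech_cocycles R gs i) R (cech_module R gs i)"
  unfolding cech_cocycles_def
  by (intro module_hom_kernel_submodule cech_module_module cech_diff_hom)

lemma cech_coboundaries_submodule: "submodule (cech_coboundaries R gs i) R (cech_module R gs i)"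
  unfolding cech_coboundaries_def
  by (cases i) (auto intro!: submodule_zero module_hom_image_submodule cech_module_module cech_diff_hom)

end

section \<open>Degree shifts\<close>

text \<open>The exponents \<open>u + k m\<close> and \<open>v + k m\<close> are then non-negative at the same time, for every
  \<open>k \<ge> N\<close> and \<open>m \<ge> 0\<close>.\<close>

definition shiftable :: "nat \<Rightarrow> ('n \<Rightarrow> int) \<Rightarrow> ('n \<Rightarrow> int) \<Rightarrow> bool" where
  "shiftable N u v \<longleftrightarrow> (\<forall>i. (0 \<le> u i \<longleftrightarrow> 0 \<le> v i) \<and> - int N \<le> u i \<and> - int N \<le> v i)"

text \<open>Coordinates with m i = 0 are decided by the common sign of u i and v i; in the others k
  m i is at least N, which compensates a negative v i.\<close>

lemma shiftable_nonneg:
  assumes "shiftable N u v" "N \<le> k" "\<forall>i. 0 \<le> u i + int k * int (m i)"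
  shows "\<forall>i. 0 \<le> v i + int k * int (m i)"
proof
  fix i
  show "0 \<le> v i + int k * int (m i)"
  proof (cases "m i = 0")
    case True
    then show ?thesis using assms(1) assms(3)[rule_format, of i] by (simp add: shiftable_def)
  next
    case False
    then have "int k * 1 \<le> int k * int (m i)" by (intro mult_left_mono) auto
    moreover have "- int N \<le> v i" using assms(1) by (simp add: shiftable_def)
    ultimately show ?thesis using assms(2) by linarith
  qed
qed

text \<open>On the localization at a term \<open>f\<close> of exponent \<open>m\<close>, this is the projection onto the component
  of degree \<open>u\<close> followed by the translation to the component of degree \<open>v\<close>.\<close>

definition shift :: "('a, 'c) ring_scheme \<Rightarrow> (('n::finite \<Rightarrow> nat) \<Rightarrow> 'a) \<Rightarrow> ('n \<Rightarrow> nat) \<Rightarrow> nat \<Rightarrow>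
    ('n \<Rightarrow> int) \<Rightarrow> ('n \<Rightarrow> int) \<Rightarrow> ((('n \<Rightarrow> nat) \<Rightarrow> 'a) \<times> nat) set \<Rightarrow> ((('n \<Rightarrow> nat) \<Rightarrow> 'a) \<times> nat) set" where
  "shift A f m N u v X = (\<Union>(r, k)\<in>{p \<in> X. N \<le> snd p}. loc_frac (mpoly_ring A) f
     (cring.zterm A (cring.zcoeff A r (\<lambda>i. u i + int k * int (m i))) (\<lambda>i. v i + int k * int (m i))) k)"

locale term_localization = cring A for A (structure) +
  fixes a and m :: "'n::finite \<Rightarrow> nat"
  assumes a_closed [simp]: "a \<in> carrier A"
begin

abbreviation P where "P \<equiv> mpoly_ring A :: (('n \<Rightarrow> nat) \<Rightarrow> 'a) ring"
abbreviation f where "f \<equiv> mterm A a m"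

sublocale P: cring P by (rule mpoly_cring)
sublocale L: cring_localization P f by unfold_locales simp

text \<open>The exponent of the numerator in a fraction of degree u with denominator f^k.\<close>

abbreviation ex :: "('n \<Rightarrow> int) \<Rightarrow> nat \<Rightarrow> 'n \<Rightarrow> int" where
  "ex u k \<equiv> \<lambda>i. u i + int k * int (m i)"

text \<open>Expanding a fraction by f^l moves the exponent to be read from \<open>ex u k\<close> to
  \<open>ex u (k + l)\<close>, so the coefficient only picks up the factor a^l.\<close>

lemma zcoeff_pow_mult:
  assumes "r \<in> carrier P"
  shows "zcoeff (f [^]\<^bsub>P\<^esub> (l::nat) \<otimes>\<^bsub>P\<^esub> r) (ex u (k + l)) = a [^] l \<otimes> zcoeff r (ex u k)"
proof -
  have "ex u (k + l) = (\<lambda>i. ex u k i + int (l * m i))"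
    by (auto simp: algebra_simps)
  then show ?thesis
    using zcoeff_mterm_mult[of "a [^] l" r "\<lambda>i. l * m i" "ex u k"] assms by (simp add: mterm_pow)
qed

lemma pow_mult_zterm:
  assumes "c \<in> carrier A" "c \<noteq> \<zero> \<Longrightarrow> \<forall>i. 0 \<le> ex v k i"
  shows "f [^]\<^bsub>P\<^esub> (l::nat) \<otimes>\<^bsub>P\<^esub> zterm c (ex v k) = zterm (a [^] l \<otimes> c) (ex v (k + l))"
proof -
  have "ex v (k + l) = (\<lambda>i. ex v k i + int (l * m i))"
    by (auto simp: algebra_simps)
  then show ?thesis
    using mterm_mult_zterm[of "a [^] l" c "ex v k" "\<lambda>i. l * m i"] assms by (simp add: mterm_pow)
qed

lemma zcoeff_nonneg: "zcoeff r w \<noteq> \<zero> \<Longrightarrow> \<forall>i. 0 \<le> w i"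
  by (auto simp: zcoeff_def split: if_splits)

text \<open>Equal fractions r/f^k and s/f^l satisfy f^(n + l) r = f^(n + k) s for some n. Taking one
  coefficient gives a relation over A with a in place of f, and writing the coefficients at the
  exponents for v carries it back to P.\<close>

lemma shift_frac:
  assumes uv: "shiftable N u v" and r: "r \<in> carrier P" and k: "N \<le> k"
  shows "shift A f m N u v (loc_frac P f r k) = loc_frac P f (zterm (zcoeff r (ex u k)) (ex v k)) k"
proof -
  have eq: "loc_frac P f (zterm (zcoeff s (ex u l)) (ex v l)) l = loc_frac P f (zterm (zcoeff r (ex u k)) (ex v k)) k"
    if sl: "(s, l) \<in> loc_frac P f r k" and l: "N \<le> l" for s l
  proof -
    obtain n :: nat where s: "s \<in> carrier P"
      and n: "f [^]\<^bsub>P\<^esub> n \<otimes>\<^bsub>P\<^esub> (f [^]\<^bsub>P\<^esub> l \<otimes>\<^bsub>P\<^esub> r) = f [^]\<^bsub>P\<^esub> n \<otimes>\<^bsub>P\<^esub> (f [^]\<^bsub>P\<^esub> k \<otimes>\<^bsub>P\<^esub> s)"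
      using sl by (auto simp: P.mem_loc_frac)
    \<comment> \<open>Here the threshold N enters: a non-zero coefficient forces the exponent for u,
      hence the one for v, to be non-negative, as \<open>pow_mult_zterm\<close> demands.\<close>
    have nn: "\<forall>i. 0 \<le> ex v j i" if "zcoeff t (ex u j) \<noteq> \<zero>" "N \<le> j" for t j
      using shiftable_nonneg[OF uv that(2)] zcoeff_nonneg[OF that(1)] by blast
    have eq: "a [^] (n + l) \<otimes> zcoeff r (ex u k) = a [^] (n + k) \<otimes> zcoeff s (ex u l)"
    proof -
      have "f [^]\<^bsub>P\<^esub> (n + l) \<otimes>\<^bsub>P\<^esub> r = f [^]\<^bsub>P\<^esub> (n + k) \<otimes>\<^bsub>P\<^esub> s"
        using n r s by (simp add: P.nat_pow_mult[symmetric] P.m_assoc)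
      \<comment> \<open>Both sides are read at the same exponent, because k + (n + l) = l + (n +
        k).\<close>
      then have "zcoeff (f [^]\<^bsub>P\<^esub> (n + l) \<otimes>\<^bsub>P\<^esub> r) (ex u (k + (n + l))) =
          zcoeff (f [^]\<^bsub>P\<^esub> (n + k) \<otimes>\<^bsub>P\<^esub> s) (ex u (l + (n + k)))"
        by (simp add: ac_simps)
      then show ?thesis using r s by (simp only: zcoeff_pow_mult)
    qed
    have "f [^]\<^bsub>P\<^esub> (n + k) \<otimes>\<^bsub>P\<^esub> zterm (zcoeff s (ex u l)) (ex v l) =
        f [^]\<^bsub>P\<^esub> (n + l) \<otimes>\<^bsub>P\<^esub> zterm (zcoeff r (ex u k)) (ex v k)"
      using r s nn k l eq by (subst (1 2) pow_mult_zterm) (auto simp: ac_simps)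
    then have "f [^]\<^bsub>P\<^esub> n \<otimes>\<^bsub>P\<^esub> (f [^]\<^bsub>P\<^esub> k \<otimes>\<^bsub>P\<^esub> zterm (zcoeff s (ex u l)) (ex v l)) =
        f [^]\<^bsub>P\<^esub> n \<otimes>\<^bsub>P\<^esub> (f [^]\<^bsub>P\<^esub> l \<otimes>\<^bsub>P\<^esub> zterm (zcoeff r (ex u k)) (ex v k))"
      using r s by (simp add: P.nat_pow_mult[symmetric] P.m_assoc)
    then show ?thesis
      using r s by (intro L.loc_frac_eqI) auto
  qed
  show ?thesis
    unfolding shift_def
  proof (rule SUP_eq_const)
    show "{p \<in> loc_frac P f r k. N \<le> snd p} \<noteq> {}"
      using L.loc_frac_self[OF r, of k] k by force
    fix p assume "p \<in> {p \<in> loc_frac P f r k. N \<le> snd p}"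
    then show "(case p of (r, k) \<Rightarrow> loc_frac P f (zterm (zcoeff r (ex u k)) (ex v k)) k) =
        loc_frac P f (zterm (zcoeff r (ex u k)) (ex v k)) k"
      using eq[of "fst p" "snd p"] by (simp only: case_prod_unfold mem_Collect_eq prod.collapse)
  qed
qed

lemma localization_cases_ge:
  assumes "X \<in> carrier (localization P f)"
  obtains r k where "r \<in> carrier P" "N \<le> k" "X = loc_frac P f r k"
proof -
  obtain r k where "r \<in> carrier P" "X = loc_frac P f r k"
    using assms by (rule L.localization_cases)
  then show thesis
    using that[of "f [^]\<^bsub>P\<^esub> N \<otimes>\<^bsub>P\<^esub> r" "N + k"] L.loc_frac_expand[of r k N] by simp
qed

lemma shift_closed:
  assumes "shiftable N u v" "X \<in> carrier (localization P f)"
  shows "shift A f m N u v X \<in> carrier (localization P f)"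
proof -
  obtain r k where "r \<in> carrier P" "N \<le> k" "X = loc_frac P f r k"
    using assms(2) by (rule localization_cases_ge)
  then show ?thesis using shift_frac[OF assms(1)] by auto
qed

lemma shift_add:
  assumes uv: "shiftable N u v" and "X \<in> carrier (localization P f)" "Y \<in> carrier (localization P f)"
  shows "shift A f m N u v (X \<oplus>\<^bsub>localization P f\<^esub> Y) =
    shift A f m N u v X \<oplus>\<^bsub>localization P f\<^esub> shift A f m N u v Y"
proof -
  obtain r k where r [simp]: "r \<in> carrier P" and k: "N \<le> k" and X: "X = loc_frac P f r k"
    using assms(2) by (rule localization_cases_ge)
  obtain s l where s [simp]: "s \<in> carrier P" and l: "N \<le> l" and Y: "Y = loc_frac P f s l"
    using assms(3) by (rule localization_cases_ge)
  have nn: "\<forall>i. 0 \<le> ex v j i" if "zcoeff t (ex u j) \<noteq> \<zero>" "N \<le> j" for t j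
    using shiftable_nonneg[OF uv that(2)] zcoeff_nonneg[OF that(1)] by blast
  have "zterm (zcoeff (f [^]\<^bsub>P\<^esub> l \<otimes>\<^bsub>P\<^esub> r \<oplus>\<^bsub>P\<^esub> f [^]\<^bsub>P\<^esub> k \<otimes>\<^bsub>P\<^esub> s) (ex u (k + l))) (ex v (k + l)) =
      zterm (a [^] l \<otimes> zcoeff r (ex u k)) (ex v (k + l)) \<oplus>\<^bsub>P\<^esub>
      zterm (a [^] k \<otimes> zcoeff s (ex u l)) (ex v (l + k))"
    using zcoeff_pow_mult[OF r, of l u k] zcoeff_pow_mult[OF s, of k u l]
    by (simp add: zcoeff_add zterm_add add.commute[of l k] del: of_nat_add)
  also have "\<dots> = f [^]\<^bsub>P\<^esub> l \<otimes>\<^bsub>P\<^esub> zterm (zcoeff r (ex u k)) (ex v k) \<oplus>\<^bsub>P\<^esub>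
      f [^]\<^bsub>P\<^esub> k \<otimes>\<^bsub>P\<^esub> zterm (zcoeff s (ex u l)) (ex v l)"
    using k l nn by (subst (1 2) pow_mult_zterm) auto
  finally show ?thesis
    using k l unfolding X Y by (simp add: L.loc_add shift_frac[OF uv])
qed

lemma mconst_mult_zterm:
  assumes "b \<in> carrier A" "c \<in> carrier A" "c \<noteq> \<zero> \<Longrightarrow> \<forall>i. 0 \<le> w i"
  shows "mconst A b \<otimes>\<^bsub>P\<^esub> zterm c w = zterm (b \<otimes> c) w"
  using mterm_mult_zterm[OF assms, of "\<lambda>_. 0"] by (simp add: mconst_def)

lemma zcoeff_mconst_mult:
  assumes "b \<in> carrier A" "r \<in> carrier P"
  shows "zcoeff (mconst A b \<otimes>\<^bsub>P\<^esub> r) w = b \<otimes> zcoeff r w"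
  using zcoeff_mterm_mult[OF assms, of "\<lambda>_. 0" w] by (simp add: mconst_def)

lemma shift_smult:
  assumes uv: "shiftable N u v" and b: "b \<in> carrier A" and "X \<in> carrier (localization P f)"
  shows "shift A f m N u v (mconst A b \<odot>\<^bsub>localization P f\<^esub> X) =
    mconst A b \<odot>\<^bsub>localization P f\<^esub> shift A f m N u v X"
proof -
  obtain r k where r [simp]: "r \<in> carrier P" and k: "N \<le> k" and X: "X = loc_frac P f r k"
    using assms(3) by (rule localization_cases_ge)
  have [simp]: "mconst A b \<in> carrier P" using b by (simp add: mconst_def)
  have "\<forall>i. 0 \<le> ex v k i" if "zcoeff r (ex u k) \<noteq> \<zero>"
    using shiftable_nonneg[OF uv k] zcoeff_nonneg[OF that] by blast
  then show ?thesis
    using k b unfolding X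
    by (simp add: L.loc_smult shift_frac[OF uv] zcoeff_mconst_mult mconst_mult_zterm)
qed

text \<open>The translated numerator carries the same coefficient, now at the exponent for v,
  because that exponent is non-negative whenever the coefficient is non-zero. So the projection onto
  degree v loses nothing.\<close>

lemma shift_shift:
  assumes uv: "shiftable N u v" and vw: "shiftable N v w" and "X \<in> carrier (localization P f)"
  shows "shift A f m N v w (shift A f m N u v X) = shift A f m N u w X"
proof -
  obtain r k where r [simp]: "r \<in> carrier P" and k: "N \<le> k" and X: "X = loc_frac P f r k"
    using assms(3) by (rule localization_cases_ge)
  have uw: "shiftable N u w" using uv vw by (auto simp: shiftable_def)
  have "zcoeff (zterm (zcoeff r (ex u k)) (ex v k)) (ex v k) = zcoeff r (ex u k)"
  proof (cases "zcoeff r (ex u k) = \<zero>")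
    case True
    then show ?thesis by (simp add: zcoeff_def zterm_def)
  next
    case False
    then show ?thesis
      using shiftable_nonneg[OF uv k] zcoeff_nonneg[OF False] by (intro zcoeff_zterm) blast
  qed
  then show ?thesis
    using k unfolding X by (simp add: shift_frac[OF uv] shift_frac[OF vw] shift_frac[OF uw])
qed

text \<open>Turns the grading into an equation that survives all the constructions: degree u means
  being fixed by the projection. \<open>loc_component\<close> admits any k and any degree d of f,
  which have to be brought to k \<ge> N and d = m.\<close>

lemma loc_component_iff:
  assumes uu: "shiftable N u u"
  shows "X \<in> loc_component A f u \<longleftrightarrow>
    X \<in> carrier (localization P f) \<and> shift A f m N u u X = X"
proof (intro iffI conjI)
  assume "X \<in> loc_component A f u"
  then obtain r k d where X: "X = loc_frac P f r k" and d: "homogeneous A d f"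
    and h: "homogeneous A (\<lambda>i. u i + int k * d i) r"
    by (auto simp: loc_component_def)
  have r [simp]: "r \<in> carrier P" using h by (simp add: homogeneous_def)
  show XL: "X \<in> carrier (localization P f)" by (simp add: X)
  show "shift A f m N u u X = X"
  proof (cases "a = \<zero>")
    \<comment> \<open>For f = 0 the degree d is undetermined, but the multiplier f^1 = 0 identifies
      all fractions; the localization is zero and each of its elements is fixed.\<close>
    case True
    then have "f = \<zero>\<^bsub>P\<^esub>" by (auto simp: mterm_def mpoly_zero)
    then have "Y = loc_frac P f \<zero>\<^bsub>P\<^esub> 0" if "Y \<in> carrier (localization P f)" for Y
      using L.localization_cases[OF that]
      by (metis L.loc_frac_eqI[where m = 1] P.l_null P.m_closed P.nat_pow_closed P.nat_pow_eone L.f_closed P.zero_closed)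
    then show ?thesis using XL shift_closed[OF uu XL] by metis
  next
    case False
    then have "d = (\<lambda>i. int (m i))"
      using d by (auto simp: homogeneous_def mterm_def fun_eq_iff)
    then have z: "zterm (zcoeff r (ex u k)) (ex u k) = r"
      using h zterm_zcoeff by simp
    \<comment> \<open>The given k may lie below N, where \<open>shift_frac\<close> does not
      apply.\<close>
    have e: "X = loc_frac P f (f [^]\<^bsub>P\<^esub> N \<otimes>\<^bsub>P\<^esub> r) (k + N)"
      unfolding X using L.loc_frac_expand[of r k N] by (simp add: add.commute)
    have "zterm (zcoeff (f [^]\<^bsub>P\<^esub> N \<otimes>\<^bsub>P\<^esub> r) (ex u (k + N))) (ex u (k + N)) =
        zterm (a [^] N \<otimes> zcoeff r (ex u k)) (ex u (k + N))"
      using r by (simp only: zcoeff_pow_mult)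
    also have "\<dots> = f [^]\<^bsub>P\<^esub> N \<otimes>\<^bsub>P\<^esub> zterm (zcoeff r (ex u k)) (ex u k)"
      using zcoeff_nonneg[of r "ex u k"] by (intro pow_mult_zterm[symmetric]) auto
    finally show ?thesis
      unfolding e using z by (simp add: shift_frac[OF uu] del: of_nat_add)
  qed
next
  assume X: "X \<in> carrier (localization P f) \<and> shift A f m N u u X = X"
  then have "X \<in> carrier (localization P f)" by blast
  then obtain r k where r: "r \<in> carrier P" "N \<le> k" "X = loc_frac P f r k"
    by (rule localization_cases_ge)
  then have "X = loc_frac P f (zterm (zcoeff r (ex u k)) (ex u k)) k"
    using X shift_frac[OF uu r(1,2)] by simp
  moreover have "homogeneous A (\<lambda>i. int (m i)) f"
    by (auto simp: homogeneous_def) (auto simp: mterm_def split: if_splits)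
  moreover have "homogeneous A (ex u k) (zterm (zcoeff r (ex u k)) (ex u k))"
    using r by (intro homogeneous_zterm) auto
  ultimately show "X \<in> loc_component A f u"
    unfolding loc_component_def by blast
qed

text \<open>For h = b X^m', the fraction r/f^k goes to h^k r/(f h)^k with the same k. The exponents
  for u and for v both grow by k m' and the coefficient is multiplied by b^k, whichever map comes
  first.\<close>

lemma shift_loc_map:
  assumes uv: "shiftable N u v" and b: "b \<in> carrier A" and "X \<in> carrier (localization P f)"
  shows "shift A (f \<otimes>\<^bsub>P\<^esub> mterm A b m') (\<lambda>i. m i + m' i) N u v (loc_map P f (mterm A b m') X) =
    loc_map P f (mterm A b m') (shift A f m N u v X)"
proof -
  obtain r k where r [simp]: "r \<in> carrier P" and k: "N \<le> k" and X: "X = loc_frac P f r k"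
    using assms(3) by (rule localization_cases_ge)
  interpret T: term_localization A "a \<otimes> b" "\<lambda>i. m i + m' i"
    by unfold_locales (simp add: b)
  have eq: "mterm A (a \<otimes> b) (\<lambda>i. m i + m' i) = f \<otimes>\<^bsub>P\<^esub> mterm A b m'"
    using b by (simp add: mterm_mult)
  have ex: "T.ex w k = (\<lambda>i. ex w k i + int (k * m' i))" for w
    by (auto simp: algebra_simps)
  have "\<forall>i. 0 \<le> ex v k i" if "zcoeff r (ex u k) \<noteq> \<zero>"
    using shiftable_nonneg[OF uv k] zcoeff_nonneg[OF that] by blast
  then have "zterm (zcoeff (mterm A b m' [^]\<^bsub>P\<^esub> k \<otimes>\<^bsub>P\<^esub> r) (T.ex u k)) (T.ex v k) =
      mterm A b m' [^]\<^bsub>P\<^esub> k \<otimes>\<^bsub>P\<^esub> zterm (zcoeff r (ex u k)) (ex v k)"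
    using b unfolding ex mterm_pow[OF b] by (subst zcoeff_mterm_mult) (auto simp: mterm_mult_zterm)
  then show ?thesis
    using k b T.shift_frac[OF uv _ k, of "mterm A b m' [^]\<^bsub>P\<^esub> k \<otimes>\<^bsub>P\<^esub> r"] unfolding X
    by (simp add: shift_frac[OF uv] L.loc_map_frac eq)
qed

end

text \<open>There are finitely many variables, so the sum of all absolute values bounds every
  coordinate at once.\<close>

lemma ex_shiftable:
  fixes u v :: "'n::finite \<Rightarrow> int"
  assumes "\<And>i. 0 \<le> u i \<longleftrightarrow> 0 \<le> v i"
  obtains N where "shiftable N u v"
proof
  have "\<bar>u i\<bar> + \<bar>v i\<bar> \<le> (\<Sum>i\<in>UNIV. \<bar>u i\<bar> + \<bar>v i\<bar>)" for i
    by (rule member_le_sum) auto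
  then have "- (\<Sum>i\<in>UNIV. \<bar>u i\<bar> + \<bar>v i\<bar>) \<le> u i \<and> - (\<Sum>i\<in>UNIV. \<bar>u i\<bar> + \<bar>v i\<bar>) \<le> v i" for i
    by (smt (verit))
  moreover have "(\<Sum>i\<in>UNIV. \<bar>u i\<bar> + \<bar>v i\<bar>) \<ge> 0"
    by (rule sum_nonneg) auto
  ultimately show "shiftable (nat (\<Sum>i\<in>UNIV. \<bar>u i\<bar> + \<bar>v i\<bar>)) u v"
    using assms by (simp add: shiftable_def)
qed

lemma shiftable_sym: "shiftable N u v \<Longrightarrow> shiftable N v u"
  and shiftable_refl: "shiftable N u v \<Longrightarrow> shiftable N u u"
  by (auto simp: shiftable_def)

section \<open>Cech complexes of lists of terms and their graded pieces\<close>

locale term_cech_complex = cring A for A (structure) +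
  fixes a :: "nat \<Rightarrow> 'a" and m :: "nat \<Rightarrow> 'n::finite \<Rightarrow> nat" and gs :: "(('n \<Rightarrow> nat) \<Rightarrow> 'a) list"
  assumes a_closed: "j < length gs \<Longrightarrow> a j \<in> carrier A"
    and gs_nth: "j < length gs \<Longrightarrow> gs ! j = mterm A (a j) (m j)"
begin

abbreviation P where "P \<equiv> mpoly_ring A :: (('n \<Rightarrow> nat) \<Rightarrow> 'a) ring"

sublocale C: cech_complex P gs
proof (intro cech_complex.intro cech_complex_axioms.intro mpoly_cring)
  show "set gs \<subseteq> carrier P"
    using a_closed gs_nth by (metis in_set_conv_nth mterm_closed subsetI)
qed

definition coef :: "nat set \<Rightarrow> 'a" where "coef S = (\<Otimes>j\<in>S. a j)"
definition expo :: "nat set \<Rightarrow> 'n \<Rightarrow> nat" where "expo S = (\<lambda>i. \<Sum>j\<in>S. m j i)"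

lemma coef_closed: "S \<subseteq> {..<length gs} \<Longrightarrow> coef S \<in> carrier A"
  unfolding coef_def by (intro finprod_closed) (auto intro: a_closed)

text \<open>Products of terms are terms, so every localization in the complex falls under
  \<open>term_localization\<close>.\<close>

lemma elt_eq:
  assumes S: "S \<subseteq> {..<length gs}"
  shows "C.elt S = mterm A (coef S) (expo S)"
proof -
  have "C.elt S = (\<Otimes>\<^bsub>P\<^esub>j\<in>S. mterm A (a j) (m j))"
    unfolding cech_elt_def using S a_closed gs_nth
    by (intro C.finprod_cong') auto
  also have "\<dots> = mterm A (coef S) (expo S)"
    unfolding coef_def expo_def using S a_closed finite_subset[OF S]
    by (intro mterm_finprod) auto
  finally show ?thesis .
qed

lemma term_localization: "S \<subseteq> {..<length gs} \<Longrightarrow> term_localization A (coef S)"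
  by unfold_locales (rule coef_closed)

definition shift_at :: "nat \<Rightarrow> ('n \<Rightarrow> int) \<Rightarrow> ('n \<Rightarrow> int) \<Rightarrow> nat set \<Rightarrow>
    ((('n \<Rightarrow> nat) \<Rightarrow> 'a) \<times> nat) set \<Rightarrow> ((('n \<Rightarrow> nat) \<Rightarrow> 'a) \<times> nat) set" where
  "shift_at N u v S = shift A (C.elt S) (expo S) N u v"

lemma shift_at_closed:
  assumes "shiftable N u v" "S \<subseteq> {..<length gs}" "X \<in> carrier (C.L S)"
  shows "shift_at N u v S X \<in> carrier (C.L S)"
  using term_localization.shift_closed[OF term_localization assms(1)] assms(2,3)
  by (simp add: shift_at_def elt_eq)

lemma shift_at_add:
  assumes "shiftable N u v" "S \<subseteq> {..<length gs}" "X \<in> carrier (C.L S)" "Y \<in> carrier (C.L S)"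
  shows "shift_at N u v S (X \<oplus>\<^bsub>C.L S\<^esub> Y) = shift_at N u v S X \<oplus>\<^bsub>C.L S\<^esub> shift_at N u v S Y"
  using term_localization.shift_add[OF term_localization assms(1)] assms(2-)
  by (simp add: shift_at_def elt_eq)

lemma shift_at_smult:
  assumes "shiftable N u v" "S \<subseteq> {..<length gs}" "b \<in> carrier A" "X \<in> carrier (C.L S)"
  shows "shift_at N u v S (mconst A b \<odot>\<^bsub>C.L S\<^esub> X) = mconst A b \<odot>\<^bsub>C.L S\<^esub> shift_at N u v S X"
  using term_localization.shift_smult[OF term_localization assms(1)] assms(2-)
  by (simp add: shift_at_def elt_eq)

lemma shift_at_shift_at:
  assumes "shiftable N u v" "shiftable N v w" "S \<subseteq> {..<length gs}" "X \<in> carrier (C.L S)"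
  shows "shift_at N v w S (shift_at N u v S X) = shift_at N u w S X"
  using term_localization.shift_shift[OF term_localization assms(1,2)] assms(3-)
  by (simp add: shift_at_def elt_eq)

lemma loc_component_elt_iff:
  assumes "shiftable N u u" "S \<subseteq> {..<length gs}"
  shows "X \<in> loc_component A (C.elt S) u \<longleftrightarrow> X \<in> carrier (C.L S) \<and> shift_at N u u S X = X"
  using term_localization.loc_component_iff[OF term_localization assms(1)] assms(2)
  by (simp add: shift_at_def elt_eq)

lemma shift_at_\<delta>:
  assumes uv: "shiftable N u v" and T: "T \<subseteq> {..<length gs}" and j: "j \<in> T"
    and X: "X \<in> carrier (C.L (T - {j}))"
  shows "shift_at N u v T (C.\<delta> T j X) = C.\<delta> T j (shift_at N u v (T - {j}) X)"
proof -
  have S: "T - {j} \<subseteq> {..<length gs}" and jl: "j < length gs" using T j by auto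
  interpret S: term_localization A "coef (T - {j})" "expo (T - {j})"
    using S by (rule term_localization)
  have "finite T" using T finite_subset by blast
  then have e: "expo T = (\<lambda>i. expo (T - {j}) i + m j i)"
    using j by (simp add: expo_def sum.remove[of T j] add.commute)
  have "mterm A (coef (T - {j})) (expo (T - {j})) \<otimes>\<^bsub>P\<^esub> mterm A (a j) (m j) = C.elt T"
    using C.elt_remove[OF T j] by (simp add: elt_eq[OF S] gs_nth[OF jl])
  then show ?thesis
    using S.shift_loc_map[OF uv a_closed[OF jl], of X "m j"] X
    by (simp add: shift_at_def elt_eq[OF S] gs_nth[OF jl] e)
qed

definition shift_cochain :: "nat \<Rightarrow> nat \<Rightarrow> ('n \<Rightarrow> int) \<Rightarrow> ('n \<Rightarrow> int) \<Rightarrow>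
    (nat set \<Rightarrow> ((('n \<Rightarrow> nat) \<Rightarrow> 'a) \<times> nat) set) \<Rightarrow> (nat set \<Rightarrow> ((('n \<Rightarrow> nat) \<Rightarrow> 'a) \<times> nat) set)" where
  "shift_cochain i N u v x = (\<lambda>S\<in>cech_index gs i. shift_at N u v S (x S))"

abbreviation cochains where "cochains i \<equiv> restrict_scalars (mconst A) (cech_module P gs i)"

lemma cochains_module: "module A (cochains i)"
  by (rule restrict_scalars_module[OF C.cech_module_module is_cring mconst_ring_hom])

lemma coboundaries_submodule: "submodule (cech_coboundaries P gs i) A (cochains i)"
  and cocycles_submodule: "submodule (cech_cocycles P gs i) A (cochains i)"
  by (rule submodule_restrict_scalars[OF C.cech_module_module is_cring mconst_ring_hom],
      rule C.cech_coboundaries_submodule C.cech_cocycles_submodule)+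

lemma carrier_cochains: "carrier (cochains i) = (\<Pi>\<^sub>E S\<in>cech_index gs i. carrier (C.L S))"
  by (simp add: restrict_scalars_def C.carrier_cech_module)

lemma shift_cochain_hom:
  assumes "shiftable N u v"
  shows "shift_cochain i N u v \<in> module_hom A (cochains i) (cochains i)"
proof (rule module_homI)
  fix x assume x: "x \<in> carrier (cochains i)"
  then have xS: "x S \<in> carrier (C.L S)" if "S \<in> cech_index gs i" for S
    using that by (auto simp: carrier_cochains)
  show "shift_cochain i N u v x \<in> carrier (cochains i)"
    using xS shift_at_closed[OF assms] C.index_subset by (auto simp: shift_cochain_def carrier_cochains)
  show "shift_cochain i N u v (b \<odot>\<^bsub>cochains i\<^esub> x) = b \<odot>\<^bsub>cochains i\<^esub> shift_cochain i N u v x"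
    if "b \<in> carrier A" for b
    using that xS shift_at_smult[OF assms C.index_subset]
    by (auto simp: shift_cochain_def restrict_scalars_def cech_module_def prod_module_def fun_eq_iff)
  fix y assume y: "y \<in> carrier (cochains i)"
  then have yS: "y S \<in> carrier (C.L S)" if "S \<in> cech_index gs i" for S
    using that by (auto simp: carrier_cochains)
  show "shift_cochain i N u v (x \<oplus>\<^bsub>cochains i\<^esub> y) =
    shift_cochain i N u v x \<oplus>\<^bsub>cochains i\<^esub> shift_cochain i N u v y"
    using xS yS shift_at_add[OF assms C.index_subset]
    by (auto simp: shift_cochain_def restrict_scalars_def cech_module_def prod_module_def fun_eq_iff)
qed

lemma cech_diff_shift_cochain:
  assumes uv: "shiftable N u v" and x: "x \<in> carrier (cochains i)"
  shows "cech_diff P gs i (shift_cochain i N u v x) = shift_cochain (Suc i) N u v (cech_diff P gs i x)"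
  unfolding shift_cochain_def
proof (rule C.cech_diff_natural)
  show "x \<in> carrier (cech_module P gs i)"
    using x by (simp add: restrict_scalars_def)
qed (fact shift_at_closed[OF uv] shift_at_add[OF uv] shift_at_\<delta>[OF uv])+

text \<open>This covers inhomogeneous coboundaries as well, because the shift acts on all cochains
  and commutes with the differential; it is what lets the shift act on cosets.\<close>

lemma shift_cochain_coboundaries:
  assumes uv: "shiftable N u v"
  shows "shift_cochain i N u v ` cech_coboundaries P gs i \<subseteq> cech_coboundaries P gs i"
proof (cases i)
  case 0
  have "shift_cochain 0 N u v \<zero>\<^bsub>cochains 0\<^esub> = \<zero>\<^bsub>cochains 0\<^esub>"
    by (rule module_hom_zero[OF cochains_module cochains_module shift_cochain_hom[OF uv]])
  then show ?thesis by (simp add: 0 cech_coboundaries_def restrict_scalars_def)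
next
  case (Suc k)
  have "shift_cochain (Suc k) N u v (cech_diff P gs k x) \<in> cech_diff P gs k ` carrier (cech_module P gs k)"
    if "x \<in> carrier (cech_module P gs k)" for x
  proof -
    have x: "x \<in> carrier (cochains k)" using that by (simp add: restrict_scalars_def)
    then have "shift_cochain k N u v x \<in> carrier (cech_module P gs k)"
      using module_homD(1)[OF shift_cochain_hom[OF uv] x] by (simp add: restrict_scalars_def)
    then show ?thesis
      using cech_diff_shift_cochain[OF uv x] by (metis imageI)
  qed
  then show ?thesis by (auto simp: Suc cech_coboundaries_def)
qed

text \<open>Encoded by fixed points so that it is a submodule at once. By
  \<open>graded_cocycles_iff\<close> the set is the same for every N with
  \<open>shiftable N u u\<close>.\<close>

definition graded_cocycles :: "nat \<Rightarrow> nat \<Rightarrow> ('n \<Rightarrow> int) \<Rightarrow> (nat set \<Rightarrow> ((('n \<Rightarrow> nat) \<Rightarrow> 'a) \<times> nat) set) set" where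
  "graded_cocycles i N u = {x \<in> cech_cocycles P gs i. shift_cochain i N u u x = x}"

lemma cocycles_cochains: "x \<in> cech_cocycles P gs i \<Longrightarrow> x \<in> carrier (cochains i)"
  by (simp add: cech_cocycles_def restrict_scalars_def)

lemma graded_cocycles_submodule:
  "shiftable N u u \<Longrightarrow> submodule (graded_cocycles i N u) A (cochains i)"
  unfolding graded_cocycles_def
  by (intro submodule_fixed_points cochains_module cocycles_submodule shift_cochain_hom)

lemma graded_cocycles_iff:
  assumes "shiftable N u u" "x \<in> cech_cocycles P gs i"
  shows "x \<in> graded_cocycles i N u \<longleftrightarrow> (\<forall>S\<in>cech_index gs i. x S \<in> loc_component A (C.elt S) u)"
proof -
  have x: "x \<in> (\<Pi>\<^sub>E S\<in>cech_index gs i. carrier (C.L S))"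
    using cocycles_cochains[OF assms(2)] by (simp add: carrier_cochains)
  have "x \<in> graded_cocycles i N u \<longleftrightarrow> (\<forall>S\<in>cech_index gs i. shift_at N u u S (x S) = x S)"
    using assms(2) x
    by (auto simp: graded_cocycles_def shift_cochain_def fun_eq_iff PiE_iff extensional_def)
  also have "\<dots> \<longleftrightarrow> (\<forall>S\<in>cech_index gs i. x S \<in> loc_component A (C.elt S) u)"
    using x loc_component_elt_iff[OF assms(1) C.index_subset] by (auto simp: PiE_iff)
  finally show ?thesis .
qed

lemma shift_cochain_shift_cochain:
  assumes "shiftable N u v" "shiftable N v w" "x \<in> carrier (cochains i)"
  shows "shift_cochain i N v w (shift_cochain i N u v x) = shift_cochain i N u w x"
  using assms(3) shift_at_shift_at[OF assms(1,2) C.index_subset]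
  by (auto simp: shift_cochain_def fun_eq_iff carrier_cochains PiE_iff)

text \<open>The shift from u to v followed by the projection onto degree v is again the shift from u
  to v, so its values are fixed by that projection.\<close>

lemma shift_cochain_graded_cocycles:
  assumes uv: "shiftable N u v"
  shows "shift_cochain i N u v ` graded_cocycles i N u \<subseteq> graded_cocycles i N v"
proof clarify
  fix x assume "x \<in> graded_cocycles i N u"
  then have Z: "x \<in> cech_cocycles P gs i" by (simp add: graded_cocycles_def)
  note x = cocycles_cochains[OF Z]
  have vv: "shiftable N v v" using uv by (auto simp: shiftable_def)
  have "cech_diff P gs i (shift_cochain i N u v x) = shift_cochain (Suc i) N u v \<zero>\<^bsub>cochains (Suc i)\<^esub>"
    using cech_diff_shift_cochain[OF uv x] Z by (simp add: cech_cocycles_def restrict_scalars_def)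
  also have "\<dots> = \<zero>\<^bsub>cochains (Suc i)\<^esub>"
    by (rule module_hom_zero[OF cochains_module cochains_module shift_cochain_hom[OF uv]])
  finally have "shift_cochain i N u v x \<in> cech_cocycles P gs i"
    using module_homD(1)[OF shift_cochain_hom[OF uv] x]
    by (simp add: cech_cocycles_def restrict_scalars_def)
  then show "shift_cochain i N u v x \<in> graded_cocycles i N v"
    using shift_cochain_shift_cochain[OF uv vv x] by (simp add: graded_cocycles_def)
qed

text \<open>Cosets and their sums depend only on addition, so restricting scalars or shrinking the
  carrier to the cocycles does not change them, and the carrier of the quotient is overwritten in
  any case. This gives M_u the form required by \<open>subquotient_iso\<close>.\<close>

lemma lc_component_eq:
  assumes "shiftable N u u"
  shows "lc_component A gs i u = (quot_module (cochains i) (cech_coboundaries P gs i))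
    \<lparr>carrier := (\<lambda>x. cech_coboundaries P gs i +>\<^bsub>cochains i\<^esub> x) ` graded_cocycles i N u\<rparr>"
proof -
  have coset: "B +>\<^bsub>cochains i\<^esub> x = B +>\<^bsub>cech_module P gs i\<^esub> x"
    "B +>\<^bsub>(cech_module P gs i)\<lparr>carrier := Z\<rparr>\<^esub> x = B +>\<^bsub>cech_module P gs i\<^esub> x" for B x Z
    by (simp_all add: a_r_coset_def' restrict_scalars_def)
  have add: "set_add (cochains i) = set_add (cech_module P gs i)"
    "set_add ((cech_module P gs i)\<lparr>carrier := Z\<rparr>) = set_add (cech_module P gs i)" for Z
    by (auto simp: fun_eq_iff set_add_def' restrict_scalars_def)
  have "{cech_coboundaries P gs i +>\<^bsub>cech_module P gs i\<^esub> x | x.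
      x \<in> cech_cocycles P gs i \<and> (\<forall>S\<in>cech_index gs i. x S \<in> loc_component A (C.elt S) u)} =
    (\<lambda>x. cech_coboundaries P gs i +>\<^bsub>cech_module P gs i\<^esub> x) ` graded_cocycles i N u"
    using graded_cocycles_iff[OF assms] by (auto simp: graded_cocycles_def)
  then show ?thesis
    by (simp add: lc_component_def Let_def local_cohomology_def quot_module_def coset add)
      (simp add: restrict_scalars_def)
qed

lemma lc_component_module: "module A (lc_component A gs i u)"
proof -
  obtain N where N: "shiftable N u u" using ex_shiftable[of u u] by auto
  show ?thesis
    unfolding lc_component_eq[OF N]
    by (intro subquotient_module cochains_module coboundaries_submodule graded_cocycles_submodule N)
qed

lemma lc_component_iso:
  assumes "u \<in> block U" "v \<in> block U"
  shows "module_iso A (lc_component A gs i u) (lc_component A gs i v)"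
proof -
  \<comment> \<open>A block fixes which coordinates are non-negative; beyond that, the shifts ask
    only for a bound.\<close>
  have "0 \<le> u i \<longleftrightarrow> 0 \<le> v i" for i
    using assms by (cases "i \<in> U") (force simp: block_def)+
  then obtain N where uv: "shiftable N u v" using ex_shiftable by blast
  \<comment> \<open>One N serves both directions and both projections, so the shifts
    compose.\<close>
  note vu = shiftable_sym[OF uv]
  note uu = shiftable_refl[OF uv] and vv = shiftable_refl[OF vu]
  show ?thesis
    unfolding lc_component_eq[OF uu] lc_component_eq[OF vv]
  proof (rule subquotient_iso[where h = "shift_cochain i N u v" and g = "shift_cochain i N v u"])
    show "shift_cochain i N v u (shift_cochain i N u v x) = x" if "x \<in> graded_cocycles i N u" for x
      using that shift_cochain_shift_cochain[OF uv vu] cocycles_cochains by (auto simp: graded_cocycles_def)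
    show "shift_cochain i N u v (shift_cochain i N v u x) = x" if "x \<in> graded_cocycles i N v" for x
      using that shift_cochain_shift_cochain[OF vu uv] cocycles_cochains by (auto simp: graded_cocycles_def)
  qed (intro cochains_module coboundaries_submodule graded_cocycles_submodule shift_cochain_hom
      shift_cochain_coboundaries shift_cochain_graded_cocycles uv vu uu vv)+
qed

end

text \<open>Coefficients and exponents are chosen per list position, since a zero generator does not
  determine its exponent.\<close>

lemma terms_term_cech_complex:
  assumes "cring A" "set gs \<subseteq> mterms A"
  obtains a m where "term_cech_complex A a m gs"
proof -
  have "\<forall>j. \<exists>am. j < length gs \<longrightarrow> fst am \<in> carrier A \<and> gs ! j = mterm A (fst am) (snd am)"
    using assms(2) by (fastforce simp: mterms_def subset_iff in_set_conv_nth)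
  then obtain am where "\<And>j. j < length gs \<Longrightarrow> fst (am j) \<in> carrier A \<and> gs ! j = mterm A (fst (am j)) (snd (am j))"
    by metis
  then have "term_cech_complex A (\<lambda>j. fst (am j)) (\<lambda>j. snd (am j)) gs"
    using assms(1) by (simp add: term_cech_complex_def term_cech_complex_axioms_def)
  then show thesis by (rule that)
qed

theorem theoremB:
  fixes A :: "'a ring" and \<pi> :: 'a and p :: nat
    and I :: "(('n::finite \<Rightarrow> nat) \<Rightarrow> 'a) set"
    and gs :: "(('n \<Rightarrow> nat) \<Rightarrow> 'a) list"
    and i :: nat
    and E :: "('a, 'e) module"
    and l t :: "('n \<Rightarrow> int) \<Rightarrow> nat" and \<beta> :: "('n \<Rightarrow> int) \<Rightarrow> nat \<Rightarrow> nat"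
  assumes "mixed_char_complete_dvr A \<pi> p"
    and "finite (carrier (A Quot (PIdl\<^bsub>A\<^esub> \<pi>)))"
    and "C_monomial_ideal A I"
    and "set gs \<subseteq> mterms A" and "I = Idl\<^bsub>mpoly_ring A\<^esub> (set gs)"
    and "injective_hull A (quot_module (self_module A) (PIdl\<^bsub>A\<^esub> \<pi>)) E"
    and "\<And>u j. j \<in> {1..t u} \<Longrightarrow> \<beta> u j \<ge> 1"
    and "\<And>u. module_iso A (torsion_module A \<pi> (lc_component A gs i u))
           (sum_module (prod_module {1..l u} (\<lambda>_. E))
             (prod_module {1..t u}
               (\<lambda>j. quot_module (self_module A) (PIdl\<^bsub>A\<^esub> (\<pi> [^]\<^bsub>A\<^esub> \<beta> u j)))))"
  shows "\<forall>U :: 'n set. \<forall>u \<in> block U. \<forall>v \<in> block U. l u = l v \<and> t u = t v"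
proof (intro allI ballI)
  fix U :: "'n set" and u v assume uv: "u \<in> block U" "v \<in> block U"
  interpret discrete_valuation_ring A \<pi>
    using assms(1) by (simp add: mixed_char_complete_dvr_def complete_dvr_def)
  obtain a m where "term_cech_complex A a m gs"
    using terms_term_cech_complex[OF is_cring assms(4)] .
  then interpret T: term_cech_complex A a m gs .
  let ?T = "\<lambda>u. torsion_module A \<pi> (lc_component A gs i u)"
  have "module_iso A (?T u) (?T v)"
    by (intro torsion_module_iso T.lc_component_module T.lc_component_iso[OF uv] uniformizer_closed)
  \<comment> \<open>Passing through the two torsion modules compares the two given decompositions
    with each other.\<close>
  then have "module_iso A (sum_module (prod_module {1..l u} (\<lambda>_. E))
      (prod_module {1..t u} (\<lambda>j. quot_module (self_module A) (PIdl\<^bsub>A\<^esub> (\<pi> [^]\<^bsub>A\<^esub> \<beta> u j))))) (?T v)"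
    using module_iso_sym[OF torsion_module_module[OF T.lc_component_module uniformizer_closed] assms(8)[of u]]
      module_iso_trans by blast
  note iso = module_iso_trans[OF this assms(8)[of v]]
  show "l u = l v \<and> t u = t v"
    by (rule decomposition_unique[OF assms(2,6) _ _ iso]; rule assms(7))
qed

end
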